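(* Let $n,p\in\mathbb N$ and let $L:\mathbb R[x]_{\le 2n}\to \mathbb S_p(\mathbb R)$ be a linear operator which admits a representing measure. Fix $t\in\mathbb R$. Let $T_i:=L((x-t)^i)$ for $i\in\{0,\dots,2n\}$ and $$\mathcal M_1:=(T_{i+j-2})_{i,j=1}^{n+1},\qquad \mathcal M_2:=(T_{i+j-2})_{i,j=1}^{n},\qquad \mathcal M_3:=(T_{i+j})_{i,j=1}^{n}.$$ Denote by $\mathbf y_j$ the $j$-th (scalar) column of $\mathcal M_1$ and let $$A:=\Big\{i\in\{1,\dots,p\}:\ \exists k\in\{1,\dots,n\}\text{ such that }\mathbf y_{kp+i}=\sum_{\ell=p+1}^{kp+i-1}\gamma_\ell\mathbf y_\ell\text{ for some }\gamma_\ell\in\mathbb R\text{ and }\mathbf y_{(k-1)p+i}\ne\sum_{\ell=1}^{(k-1)p+i-1}\delta_\ell\mathbf y_\ell\text{ for all }\delta_\ell\in\mathbb R\Big\}.$$ The following statements are equivalent: (1) There exists a minimal representing measure $\mu$ for $L$ such that $\operatorname{mult}_\mu t=0$. (2) $A=\emptyset$. (3) $\ker\mathcal M_2=\ker\mathcal M_3$.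
   Context: $\mathbb N=\{1,2,\dots\}$. $\mathbb R[x]_{\le k}$ is the space of real univariate polynomials of degree at most $k$; $\mathbb S_p(\mathbb R)$ is the space of real symmetric $p\times p$ matrices. A positive $\mathbb S_p(\mathbb R)$-valued measure is a map $\mu=(\mu_{ij})_{i,j=1}^p:\mathrm{Bor}(\mathbb R)\to\mathbb S_p(\mathbb R)$ such that every $\mu_{ij}$ is a real (signed) measure and $\mu(\Delta)$ is positive semidefinite for each Borel set $\Delta$. A polynomial $f$ is $\mu$-integrable if $f\in L^1(\tau)$ with $\tau=\sum_i\mu_{ii}$, and then $\int f\,d\mu:=(\int f\,d\mu_{ij})_{i,j=1}^p$. It is a representing measure for $L$ if $L(f)=\int_{\mathbb R}f\,d\mu$ for all $f\in\mathbb R[x]_{\le 2n}$. Let $M(n):=(L(x^{i+j-2}))_{i,j=1}^{n+1}$ (the moment matrix of $L$). A representing measure for $L$ is minimal if it has the form $\mu=\sum_{j=1}^{\ell}\delta_{x_j}A_j$ with $\ell\in\mathbb N$, pairwise distinct $x_j\in\mathbb R$, nonzero positive semidefinite $A_j\in\mathbb S_p(\mathbb R)$, and $\sum_{j=1}^\ell\operatorname{rank}A_j=\operatorname{rank}M(n)$ (this is the smallest possible total rank of the masses among finitely atomic representing measures of $L$). Here $\delta_{x}$ is the Dirac measure at $x$. The multiplicity of $t$ in $\mu$ is $\operatorname{mult}_\mu t:=\operatorname{rank}\mu(\{t\})$ (which is $0$ iff $t$ is not an atom). Empty sums equal $0$.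
   Formalization: A minimal representing measure may have ℓ = 0 atoms (the zero measure); with ℓ ≥ 1 and nonzero masses, statement (1) would fail for L = 0 while (2) and (3) hold. For L ≠ 0 nothing changes. *)

theory Defs
  imports
    "HOL-Probability.Giry_Monad"
    "HOL-Computational_Algebra.Polynomial"
    "Jordan_Normal_Form.Matrix_Kernel"
    "Jordan_Normal_Form.DL_Rank"
begin

definition sym_mats :: "nat \<Rightarrow> real mat set" where
  "sym_mats p = {A \<in> carrier_mat p p. A\<^sup>T = A}"

definition psd :: "nat \<Rightarrow> real mat \<Rightarrow> bool" where
  "psd p A \<longleftrightarrow> A \<in> sym_mats p \<and> (\<forall>v \<in> carrier_vec p. v \<bullet> (A *\<^sub>v v) \<ge> 0)"

definition linear_operator :: "nat \<Rightarrow> nat \<Rightarrow> (real poly \<Rightarrow> real mat) \<Rightarrow> bool" where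
  "linear_operator d p L \<longleftrightarrow>
     (\<forall>f. degree f \<le> d \<longrightarrow> L f \<in> sym_mats p) \<and>
     (\<forall>f g. degree f \<le> d \<longrightarrow> degree g \<le> d \<longrightarrow> L (f + g) = L f + L g) \<and>
     (\<forall>c f. degree f \<le> d \<longrightarrow> L (Polynomial.smult c f) = c \<cdot>\<^sub>m L f)"

definition signed_borel_measure :: "(real set \<Rightarrow> real) \<Rightarrow> bool" where
  "signed_borel_measure \<nu> \<longleftrightarrow> \<nu> {} = 0 \<and>
     (\<forall>B :: nat \<Rightarrow> real set. range B \<subseteq> sets borel \<longrightarrow> disjoint_family B \<longrightarrow>
        (\<lambda>k. \<nu> (B k)) sums \<nu> (\<Union>k. B k))"

(* The positive part of the Jordan decomposition, as the upper variation
   \<nu>\<^sup>+(B) = sup {\<nu>(C) | C Borel, C \<subseteq> B}; ennreal sends negative values to 0, which is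
   harmless since C = {} contributes 0. *)
definition upper_variation :: "(real set \<Rightarrow> real) \<Rightarrow> real measure" where
  "upper_variation \<nu> = measure_of UNIV (sets borel)
     (\<lambda>B. SUP C \<in> {C \<in> sets borel. C \<subseteq> B}. ennreal (\<nu> C))"

definition signed_integral :: "(real set \<Rightarrow> real) \<Rightarrow> (real \<Rightarrow> real) \<Rightarrow> real" where
  "signed_integral \<nu> f =
     integral\<^sup>L (upper_variation \<nu>) f - integral\<^sup>L (upper_variation (\<lambda>B. - \<nu> B)) f"

(* Matrix measures are set functions; only their values on Borel sets are meaningful. *)
definition positive_matrix_measure :: "nat \<Rightarrow> (real set \<Rightarrow> real mat) \<Rightarrow> bool" where
  "positive_matrix_measure p \<mu> \<longleftrightarrow>
     (\<forall>i<p. \<forall>j<p. signed_borel_measure (\<lambda>B. \<mu> B $$ (i, j))) \<and>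
     (\<forall>B \<in> sets borel. psd p (\<mu> B))"

definition trace_measure :: "nat \<Rightarrow> (real set \<Rightarrow> real mat) \<Rightarrow> real measure" where
  "trace_measure p \<mu> = measure_of UNIV (sets borel) (\<lambda>B. ennreal (\<Sum>i<p. \<mu> B $$ (i, i)))"

definition matrix_integrable :: "nat \<Rightarrow> (real set \<Rightarrow> real mat) \<Rightarrow> real poly \<Rightarrow> bool" where
  "matrix_integrable p \<mu> f \<longleftrightarrow> integrable (trace_measure p \<mu>) (poly f)"

definition matrix_integral :: "nat \<Rightarrow> (real set \<Rightarrow> real mat) \<Rightarrow> real poly \<Rightarrow> real mat" where
  "matrix_integral p \<mu> f =
     mat p p (\<lambda>(i, j). signed_integral (\<lambda>B. \<mu> B $$ (i, j)) (poly f))"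

definition representing_measure ::
  "nat \<Rightarrow> nat \<Rightarrow> (real poly \<Rightarrow> real mat) \<Rightarrow> (real set \<Rightarrow> real mat) \<Rightarrow> bool" where
  "representing_measure n p L \<mu> \<longleftrightarrow> positive_matrix_measure p \<mu> \<and>
     (\<forall>f. degree f \<le> 2 * n \<longrightarrow> matrix_integrable p \<mu> f \<and> L f = matrix_integral p \<mu> f)"

(* The m \<times> m block Hankel matrix with p \<times> p blocks S (i + j), for i, j = 0, ..., m - 1. *)
definition block_hankel :: "nat \<Rightarrow> nat \<Rightarrow> (nat \<Rightarrow> real mat) \<Rightarrow> real mat" where
  "block_hankel p m S =
     mat (m * p) (m * p) (\<lambda>(r, c). S (r div p + c div p) $$ (r mod p, c mod p))"

definition moment_matrix :: "nat \<Rightarrow> nat \<Rightarrow> (real poly \<Rightarrow> real mat) \<Rightarrow> real mat" where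
  "moment_matrix n p L = block_hankel p (n + 1) (\<lambda>i. L (monom 1 i))"

abbreviation mat_rank :: "real mat \<Rightarrow> nat" where
  "mat_rank M \<equiv> vec_space.rank (dim_row M) M"

(* The value l = 0 is allowed: it is the zero measure, and it occurs only for L = 0. *)
definition minimal_representing_measure ::
  "nat \<Rightarrow> nat \<Rightarrow> (real poly \<Rightarrow> real mat) \<Rightarrow> (real set \<Rightarrow> real mat) \<Rightarrow> bool" where
  "minimal_representing_measure n p L \<mu> \<longleftrightarrow> representing_measure n p L \<mu> \<and>
     (\<exists>(l :: nat) (x :: nat \<Rightarrow> real) (A :: nat \<Rightarrow> real mat).
        inj_on x {..<l} \<and>
        (\<forall>j<l. psd p (A j) \<and> A j \<noteq> 0\<^sub>m p p) \<and>
        (\<forall>B \<in> sets borel.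
           \<mu> B = mat p p (\<lambda>(a, b). \<Sum>j<l. measure (return borel (x j)) B * A j $$ (a, b))) \<and>
        (\<Sum>j<l. mat_rank (A j)) = mat_rank (moment_matrix n p L))"

definition atom_mult :: "(real set \<Rightarrow> real mat) \<Rightarrow> real \<Rightarrow> nat" where
  "atom_mult \<mu> t = mat_rank (\<mu> {t})"

end

theory Submission
  imports Defs "Jordan_Normal_Form.Spectral_Radius"
begin

text \<open>On \<open>p\<close>-tuples of polynomials of degree at most \<open>n\<close>, \<open>L\<close> induces a positive semidefinite form
  whose Gram matrix in the basis \<open>(x - t)\<^sup>k e\<^sub>i\<close> is \<open>M1\<close>. Since \<open>L\<close> has a representing measure,
  multiplication by \<open>x - t\<close> maps null vectors to null vectors, hence is a symmetric operator from the
  tuples of degree below \<open>n\<close> into all tuples, modulo null vectors. All three conditions say that this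
  operator is injective: \<open>M2\<close> and \<open>M3\<close> are the Gram matrices of its domain and of its range, and
  \<open>A\<close> collects the pivots killed by it. A measure without mass at \<open>t\<close> forces injectivity, because
  \<open>x - t\<close> vanishes only at \<open>t\<close>. Conversely, an injective operator has an invertible self-adjoint
  extension; its orthonormal eigenvectors \<open>e\<^sub>k\<close> with eigenvalues \<open>z\<^sub>k \<noteq> 0\<close> give
  \<open>L(f) = \<Sum>\<^sub>k f(t + z\<^sub>k) a\<^sub>k a\<^sub>k\<^sup>T\<close> with \<open>a\<^sub>k\<close> the pairings of \<open>e\<^sub>k\<close> with the constants, and grouping
  equal nodes yields a minimal measure.\<close>

subsection \<open>Semi-inner products on coefficient sequences\<close>

text \<open>The quotient by null vectors is never formed: vectors remain coefficient sequences, and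
  two of them count as equal when their difference is null. Positivity of \<open>M1\<close> alone
  does not let multiplication by \<open>x - t\<close> pass to classes. A density of the measure with
  respect to its trace does: it turns nullness of a tuple into a pointwise condition holding almost
  everywhere, and such a condition survives multiplication by a polynomial and, away from
  \<open>t\<close>, division by \<open>x - t\<close>.

  The extension acts on the same finite-dimensional space of classes, without enlarging it. This is
  why the resulting measure is minimal: the number of eigenvectors is the dimension of that space,
  which is the rank of the moment matrix. The freedom that avoids the eigenvalue 0 lies in the
  corner of the extension on the orthogonal complement of the domain, where any symmetric block is
  admissible and a scalar one suffices.

  The formula for \<open>L\<close> arises by moving factors \<open>x - t\<close> one at a time onto
  an eigenvector. At most \<open>n\<close> of them can be moved from one argument, and the moments
  up to order \<open>2 * n\<close> are pairings of two basis vectors.\<close>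

definition supported_below :: "nat \<Rightarrow> (nat \<Rightarrow> real) set" where
  "supported_below m = {f. \<forall>i\<ge>m. f i = 0}"

lemma supported_below_mono: "m \<le> m' \<Longrightarrow> supported_below m \<subseteq> supported_below m'"
  by (auto simp: supported_below_def)

lemma supported_below_sum:
  "(\<And>a. a \<in> I \<Longrightarrow> q a \<in> supported_below m) \<Longrightarrow> (\<lambda>i. \<Sum>a\<in>I. c a * q a i) \<in> supported_below m"
  by (auto simp: supported_below_def intro!: sum.neutral)

lemma supported_below_unit: "i < m \<Longrightarrow> (\<lambda>j. of_bool (j = i)) \<in> supported_below m"
  by (auto simp: supported_below_def)

text \<open>Definiteness is deliberately absent, because the moment matrix may be singular. The form
  lives on all sequences; supports are tracked separately.\<close>

locale semi_inner =
  fixes B :: "(nat \<Rightarrow> real) \<Rightarrow> (nat \<Rightarrow> real) \<Rightarrow> real"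
  assumes commute: "B f g = B g f"
    and add_left: "B (\<lambda>i. f i + g i) h = B f h + B g h"
    and scale_left: "B (\<lambda>i. c * f i) h = c * B f h"
    and nonneg: "B f f \<ge> 0"
begin

lemma add_right: "B h (\<lambda>i. f i + g i) = B h f + B h g"
  using add_left commute by metis

lemma scale_right: "B h (\<lambda>i. c * f i) = c * B h f"
  using scale_left commute by metis

lemma diff_left: "B (\<lambda>i. f i - g i) h = B f h - B g h"
  using add_left[of f "\<lambda>i. (-1) * g i" h] scale_left[of "-1" g h] by simp

lemma diff_right: "B h (\<lambda>i. f i - g i) = B h f - B h g"
  using diff_left commute by metis

lemma zero_left: "B (\<lambda>i. 0) h = 0"
  using scale_left[of 0 "\<lambda>i. 0" h] by simp

lemma sum_left: "B (\<lambda>i. \<Sum>a\<in>I. c a * q a i) h = (\<Sum>a\<in>I. c a * B (q a) h)"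
  by (induction I rule: infinite_finite_induct) (simp_all add: zero_left add_left scale_left)

lemma sum_right: "B h (\<lambda>i. \<Sum>a\<in>I. c a * q a i) = (\<Sum>a\<in>I. c a * B h (q a))"
  using sum_left commute by simp

text \<open>Cauchy-Schwarz for a degenerate form: if \<open>B f g\<close> were nonzero, the square
  of \<open>c f + g\<close> would be a nonconstant affine function of \<open>c\<close>. The chosen
  \<open>c\<close> gives it the value -1.\<close>

lemma null_orthogonal:
  assumes "B f f = 0"
  shows "B f g = 0"
proof (rule ccontr)
  assume nz: "B f g \<noteq> 0"
  define c where "c = - (B g g + 1) / (2 * B f g)"
  have "0 \<le> B (\<lambda>i. c * f i + g i) (\<lambda>i. c * f i + g i)" by (rule nonneg)
  also have "\<dots> = 2 * c * B f g + B g g"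
    using assms by (simp add: add_left add_right scale_left scale_right commute[of g f])
  also have "\<dots> = -1" using nz by (simp add: c_def field_simps)
  finally show False by simp
qed

lemma null_orthogonal': "B f f = 0 \<Longrightarrow> B g f = 0"
  using null_orthogonal commute by metis

lemma null_diff_cong: "B (\<lambda>i. f i - g i) (\<lambda>i. f i - g i) = 0 \<Longrightarrow> B f h = B g h"
  using null_orthogonal[of "\<lambda>i. f i - g i" h] by (simp add: diff_left)

definition orthonormal :: "(nat \<Rightarrow> real) list \<Rightarrow> bool" where
  "orthonormal qs \<longleftrightarrow> (\<forall>a<length qs. \<forall>b<length qs. B (qs ! a) (qs ! b) = of_bool (a = b))"

text \<open>Spanning is expressed through orthogonality, up to null vectors. With orthonormality and
  the right support it says that \<open>qs\<close> is a basis of the classes of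
  \<open>supported_below m\<close>.\<close>

definition complete_below :: "nat \<Rightarrow> (nat \<Rightarrow> real) list \<Rightarrow> bool" where
  "complete_below m qs \<longleftrightarrow> (\<forall>f\<in>supported_below m. (\<forall>q\<in>set qs. B f q = 0) \<longrightarrow> B f f = 0)"

lemma orthonormal_sum:
  assumes "orthonormal qs" "b < length qs"
  shows "B (\<lambda>i. \<Sum>a<length qs. c a * (qs ! a) i) (qs ! b) = c b"
proof -
  have "B (\<lambda>i. \<Sum>a<length qs. c a * (qs ! a) i) (qs ! b) = (\<Sum>a<length qs. c a * of_bool (a = b))"
    using assms unfolding sum_left orthonormal_def by (intro sum.cong) auto
  also have "\<dots> = c b" using assms(2) by (simp add: of_bool_def if_distrib cong: if_cong)
  finally show ?thesis .
qed

text \<open>The remainder is supported below \<open>m\<close> and orthogonal to every member of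
  \<open>qs\<close>, so completeness makes it null.\<close>

lemma fourier_left:
  assumes "orthonormal qs" "set qs \<subseteq> supported_below m" "complete_below m qs" "f \<in> supported_below m"
  shows "B (\<lambda>i. f i - (\<Sum>a<length qs. B f (qs ! a) * (qs ! a) i))
           (\<lambda>i. f i - (\<Sum>a<length qs. B f (qs ! a) * (qs ! a) i)) = 0"
proof -
  let ?g = "\<lambda>i. f i - (\<Sum>a<length qs. B f (qs ! a) * (qs ! a) i)"
  have "(\<lambda>i. \<Sum>a<length qs. B f (qs ! a) * (qs ! a) i) \<in> supported_below m"
    using assms(2) by (intro supported_below_sum) auto
  then have "?g \<in> supported_below m" using assms(4) by (auto simp: supported_below_def)
  moreover have "B ?g q = 0" if q: "q \<in> set qs" for q
  proof -
    obtain b where b: "b < length qs" "q = qs ! b" using q by (auto simp: in_set_conv_nth)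
    show ?thesis unfolding b(2) diff_left orthonormal_sum[OF assms(1) b(1)] by simp
  qed
  ultimately show ?thesis using assms(3) unfolding complete_below_def by blast
qed

text \<open>Only the unit vector at \<open>m\<close> is new. Its remainder \<open>u\<close> after
  projection is either null, and nothing is appended, or it is normalised and appended.\<close>

lemma gram_schmidt_step:
  assumes qs: "orthonormal qs" "set qs \<subseteq> supported_below m" "complete_below m qs"
  shows "\<exists>qs'. orthonormal (qs @ qs') \<and> set (qs @ qs') \<subseteq> supported_below (Suc m)
           \<and> complete_below (Suc m) (qs @ qs')"
proof -
  define u where "u = (\<lambda>i. of_bool (i = m) - (\<Sum>a<length qs. B (\<lambda>i. of_bool (i = m)) (qs ! a) * (qs ! a) i))"
  have qm: "(qs ! a) i = 0" if "a < length qs" "i \<ge> m" for a i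
    using qs(2) that nth_mem[OF that(1)] unfolding supported_below_def by blast
  \<comment> \<open>Members of \<open>qs\<close> vanish at \<open>m\<close>, so \<open>u\<close>
    keeps leading coefficient 1, and subtracting \<open>f m\<close> times \<open>u\<close> brings
    \<open>f\<close> down to support below \<open>m\<close>.\<close>
  have um: "u m = 1" by (simp add: u_def qm)
  have u_supp: "u \<in> supported_below (Suc m)" by (auto simp: supported_below_def u_def qm)
  have uq: "B u (qs ! b) = 0" if "b < length qs" for b
    unfolding u_def diff_left orthonormal_sum[OF qs(1) that] by simp
  have compl: "B f f = 0" if f: "f \<in> supported_below (Suc m)" and fq: "\<forall>q\<in>set qs. B f q = 0"
    and fu: "B u f = 0" for f
  proof -
    define f' where "f' = (\<lambda>i. f i - f m * u i)"
    have "f' i = 0" if "i \<ge> m" for i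
      using f u_supp that um by (cases "i = m") (auto simp: f'_def supported_below_def)
    then have "f' \<in> supported_below m" by (simp add: supported_below_def)
    moreover have "B f' q = 0" if q: "q \<in> set qs" for q
    proof -
      obtain b where "b < length qs" "q = qs ! b" using q by (auto simp: in_set_conv_nth)
      then have "B u q = 0" "B f q = 0" using fq uq q by auto
      then show ?thesis unfolding f'_def diff_left scale_left by simp
    qed
    ultimately have "B f' f' = 0" using qs(3) unfolding complete_below_def by blast
    then have "B f' f = 0" by (rule null_orthogonal)
    then show ?thesis using fu unfolding f'_def diff_left scale_left by simp
  qed
  have sub: "set qs \<subseteq> supported_below (Suc m)" using qs(2) supported_below_mono[of m "Suc m"] by auto
  show ?thesis
  proof (cases "B u u = 0")
    case True
    then have "complete_below (Suc m) (qs @ [])"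
      using compl null_orthogonal[OF True] by (auto simp: complete_below_def)
    then show ?thesis using qs(1) sub by (metis append_Nil2)
  next
    case False
    then have pos: "B u u > 0" using nonneg[of u] by simp
    define s where "s = 1 / sqrt (B u u)"
    define q where "q = (\<lambda>i. s * u i)"
    have s: "s \<noteq> 0" "s * s * B u u = 1" using pos by (simp_all add: s_def)
    have qq: "B q q = 1" using s by (simp add: q_def scale_left scale_right)
    have "orthonormal (qs @ [q])"
      unfolding orthonormal_def
    proof (intro allI impI)
      fix a b assume "a < length (qs @ [q])" "b < length (qs @ [q])"
      then show "B ((qs @ [q]) ! a) ((qs @ [q]) ! b) = of_bool (a = b)"
        using qs(1) qq uq commute[of _ q]
        by (auto simp: orthonormal_def nth_append less_Suc_eq q_def scale_left)
    qed
    moreover have "set (qs @ [q]) \<subseteq> supported_below (Suc m)"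
      using sub u_supp by (auto simp: q_def supported_below_def)
    moreover have "complete_below (Suc m) (qs @ [q])"
    proof -
      have "B f f = 0" if "f \<in> supported_below (Suc m)" "\<forall>r\<in>set (qs @ [q]). B f r = 0" for f
        using that compl[of f] s(1) commute[of f u] by (simp add: q_def scale_right)
      then show ?thesis by (simp add: complete_below_def)
    qed
    ultimately show ?thesis by blast
  qed
qed

text \<open>The given list stays a prefix, so that a basis of the domain of the shift can be
  prolonged to one of the whole space.\<close>

lemma gram_schmidt:
  assumes "orthonormal qs" "set qs \<subseteq> supported_below m" "complete_below m qs"
  shows "\<exists>qs'. orthonormal (qs @ qs') \<and> set (qs @ qs') \<subseteq> supported_below (m + d)
           \<and> complete_below (m + d) (qs @ qs')"
proof (induction d)
  case 0
  then show ?case using assms by (metis append_Nil2 add_0_right)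
next
  case (Suc d)
  then obtain qs' where "orthonormal (qs @ qs')" "set (qs @ qs') \<subseteq> supported_below (m + d)"
    "complete_below (m + d) (qs @ qs')" by blast
  from gram_schmidt_step[OF this] show ?case by (metis append_assoc add_Suc_right)
qed

lemma orthonormal_Nil: "orthonormal []"
  by (simp add: orthonormal_def)

lemma complete_below_0: "complete_below 0 []"
  using zero_left by (auto simp: complete_below_def supported_below_def fun_eq_iff[symmetric])

end

subsection \<open>The spectral theorem for real symmetric forms\<close>

text \<open>A complex eigenvalue exists in positive dimension. Symmetry makes it real, so the real
  and imaginary parts of an eigenvector satisfy the same equation, and one of them is
  nonzero.\<close>

lemma real_symmetric_eigenvector:
  fixes S :: "nat \<Rightarrow> nat \<Rightarrow> real"
  assumes r: "r > 0" and sym: "\<And>i j. i < r \<Longrightarrow> j < r \<Longrightarrow> S i j = S j i"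
  shows "\<exists>u z. (\<Sum>i<r. u i * u i) = 1 \<and> (\<forall>i<r. (\<Sum>j<r. S i j * u j) = z * u i)"
proof -
  define A where "A = mat r r (\<lambda>(i, j). complex_of_real (S i j))"
  have A: "A \<in> carrier_mat r r" by (simp add: A_def)
  obtain k where "k \<in> spectrum A" using spectrum_non_empty[OF A r] by blast
  then obtain v where v: "v \<in> carrier_vec r" "v \<noteq> 0\<^sub>v r" "A *\<^sub>v v = k \<cdot>\<^sub>v v"
    using A unfolding spectrum_def eigenvalue_def eigenvector_def by auto
  define a b where "a = (\<lambda>i. Re (v $ i))" and "b = (\<lambda>i. Im (v $ i))"
  have ev: "(\<Sum>j<r. complex_of_real (S i j) * v $ j) = k * v $ i" if i: "i < r" for i
  proof -
    have "(A *\<^sub>v v) $ i = (\<Sum>j<r. complex_of_real (S i j) * v $ j)"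
      using i v(1) A by (simp add: A_def scalar_prod_def atLeast0LessThan)
    then show ?thesis using v i by simp
  qed
  have Re: "(\<Sum>j<r. S i j * a j) = Re k * a i - Im k * b i" if "i < r" for i
    using arg_cong[OF ev[OF that], of Re] by (simp add: a_def b_def Re_sum)
  have Im: "(\<Sum>j<r. S i j * b j) = Re k * b i + Im k * a i" if "i < r" for i
    using arg_cong[OF ev[OF that], of Im] by (simp add: a_def b_def Im_sum)
  have nz: "\<exists>i<r. a i \<noteq> 0 \<or> b i \<noteq> 0"
  proof (rule ccontr)
    assume "\<not> ?thesis"
    then have "v = 0\<^sub>v r" using v(1) by (intro eq_vecI) (auto simp: a_def b_def complex_eq_iff)
    then show False using v(2) by simp
  qed
  \<comment> \<open>Symmetry equates the pairing of \<open>b\<close> with \<open>S a\<close> and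
    that of \<open>a\<close> with \<open>S b\<close>. Inserting the eigenvalue equations leaves
    \<open>Im k\<close> times the squared length of the eigenvector.\<close>
  have "(\<Sum>i<r. b i * (\<Sum>j<r. S i j * a j)) = (\<Sum>i<r. \<Sum>j<r. S i j * b i * a j)"
    by (simp add: sum_distrib_left mult_ac)
  also have "\<dots> = (\<Sum>j<r. \<Sum>i<r. S i j * b i * a j)" by (rule sum.swap)
  also have "\<dots> = (\<Sum>j<r. \<Sum>i<r. S j i * b i * a j)" by (intro sum.cong refl) (simp add: sym)
  also have "\<dots> = (\<Sum>i<r. a i * (\<Sum>j<r. S i j * b j))"
    by (simp add: sum_distrib_left mult_ac)
  finally have "(\<Sum>i<r. b i * (Re k * a i - Im k * b i)) = (\<Sum>i<r. a i * (Re k * b i + Im k * a i))"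
    by (simp add: Re Im)
  then have "Im k * (\<Sum>i<r. a i * a i + b i * b i) = 0"
    by (simp add: algebra_simps sum.distrib sum_subtractf sum_distrib_left)
  moreover have "(\<Sum>i<r. a i * a i + b i * b i) > 0"
  proof -
    obtain i where i: "i < r" "a i \<noteq> 0 \<or> b i \<noteq> 0" using nz by blast
    then have "a i * a i + b i * b i > 0" using sum_squares_gt_zero_iff by blast
    then show ?thesis using i(1) by (intro sum_pos2[of "{..<r}" i]) auto
  qed
  ultimately have k: "Im k = 0" by auto
  obtain u where u: "\<exists>i<r. u i \<noteq> 0" "\<forall>i<r. (\<Sum>j<r. S i j * u j) = Re k * u i"
  proof (cases "\<exists>i<r. a i \<noteq> 0")
    case True
    then show ?thesis using that[of a] Re k by simp
  next
    case False
    then have "\<exists>i<r. b i \<noteq> 0" using nz by blast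
    then show ?thesis using that[of b] Im k by simp
  qed
  define s where "s = (\<Sum>i<r. u i * u i)"
  have s: "s > 0"
  proof -
    obtain i where i: "i < r" "u i \<noteq> 0" using u(1) by blast
    then have "u i * u i > 0" using zero_less_mult_iff[of "u i" "u i"] by linarith
    then show ?thesis using i(1) unfolding s_def by (intro sum_pos2[of "{..<r}" i]) auto
  qed
  define w where "w = (\<lambda>i. u i / sqrt s)"
  have "(\<Sum>i<r. w i * w i) = s / s"
    using s by (simp add: w_def sum_divide_distrib[symmetric]) (simp add: s_def)
  moreover have "(\<Sum>j<r. S i j * w j) = Re k * w i" if "i < r" for i
    using u(2) that by (simp add: w_def sum_divide_distrib[symmetric])
  ultimately show ?thesis using s by (intro exI[of _ w] exI[of _ "Re k"]) auto
qed

section \<open>Dot products and symmetric forms in finite dimension\<close>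

definition dot :: "nat \<Rightarrow> (nat \<Rightarrow> real) \<Rightarrow> (nat \<Rightarrow> real) \<Rightarrow> real" where
  "dot r f g = (\<Sum>i<r. f i * g i)"

interpretation dot: semi_inner "dot r" for r
  by unfold_locales
    (auto simp: dot_def mult.commute distrib_left sum.distrib sum_distrib_left mult.left_commute
      intro: sum_nonneg)

lemma dot_cong: "(\<And>i. i < r \<Longrightarrow> f i = f' i) \<Longrightarrow> (\<And>i. i < r \<Longrightarrow> g i = g' i) \<Longrightarrow> dot r f g = dot r f' g'"
  by (simp add: dot_def)

lemma dot_unit: "i < r \<Longrightarrow> dot r f (\<lambda>j. of_bool (j = i)) = f i"
  by (simp add: dot_def of_bool_def if_distrib cong: if_cong)

lemma dot_unit': "i < r \<Longrightarrow> dot r (\<lambda>j. of_bool (j = i)) f = f i"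
  using dot_unit dot.commute by metis

text \<open>Bessel's inequality for the coordinate vector at \<open>a\<close> bounds the sum of the
  squares \<open>v i a * v i a\<close> by 1. Summing over the \<open>r\<close> coordinates yields
  all squared lengths, \<open>m\<close> in total.\<close>

lemma orthonormal_card_le:
  assumes "\<And>i j. i < m \<Longrightarrow> j < m \<Longrightarrow> dot r (v i) (v j) = of_bool (i = j)"
  shows "m \<le> r"
proof -
  have le: "(\<Sum>i<m. v i a * v i a) \<le> 1" if a: "a < r" for a
  proof -
    let ?e = "\<lambda>j. of_bool (j = a) :: real"
    let ?s = "\<lambda>j. \<Sum>i<m. v i a * v i j"
    have ss: "dot r ?s ?s = (\<Sum>i<m. v i a * v i a)"
    proof -
      have "dot r (v i) ?s = v i a" if "i < m" for i
      proof -
        have "dot r (v i) ?s = (\<Sum>j<m. v j a * of_bool (i = j))"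
          unfolding dot.sum_right using assms that by (intro sum.cong) auto
        then show ?thesis using that by (simp add: of_bool_def if_distrib cong: if_cong)
      qed
      then show ?thesis unfolding dot.sum_left by simp
    qed
    have es: "dot r ?e ?s = (\<Sum>i<m. v i a * v i a)" using a by (simp add: dot_unit')
    have ee: "dot r ?e ?e = 1" using a by (simp add: dot_unit')
    have "0 \<le> dot r (\<lambda>j. ?e j - ?s j) (\<lambda>j. ?e j - ?s j)" by (rule dot.nonneg)
    then show ?thesis
      unfolding dot.diff_left dot.diff_right using ss es ee dot.commute[of r ?s ?e] by linarith
  qed
  have "real m = (\<Sum>i<m. dot r (v i) (v i))" using assms by simp
  also have "\<dots> = (\<Sum>a<r. \<Sum>i<m. v i a * v i a)" unfolding dot_def by (rule sum.swap)
  also have "\<dots> \<le> (\<Sum>a<r. 1)" using le by (intro sum_mono) auto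
  finally show ?thesis by simp
qed

text \<open>A form rather than a matrix, so that compressing it to a smaller dimension is mere
  composition with maps. \<open>cong_left\<close> says that only the first \<open>r\<close>
  coordinates are read.\<close>

locale sym_form =
  fixes r :: nat and K :: "(nat \<Rightarrow> real) \<Rightarrow> (nat \<Rightarrow> real) \<Rightarrow> real"
  assumes commute: "K f g = K g f"
    and add_left: "K (\<lambda>i. f i + g i) h = K f h + K g h"
    and scale_left: "K (\<lambda>i. c * f i) h = c * K f h"
    and cong_left: "(\<And>i. i < r \<Longrightarrow> f i = f' i) \<Longrightarrow> K f h = K f' h"
begin

lemma add_right: "K h (\<lambda>i. f i + g i) = K h f + K h g"
  using add_left commute by metis

lemma scale_right: "K h (\<lambda>i. c * f i) = c * K h f"
  using scale_left commute by metis

lemma zero_left: "K (\<lambda>i. 0) h = 0"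
  using scale_left[of 0 "\<lambda>i. 0" h] by simp

lemma sum_left: "K (\<lambda>i. \<Sum>a\<in>I. c a * q a i) h = (\<Sum>a\<in>I. c a * K (q a) h)"
  by (induction I rule: infinite_finite_induct) (simp_all add: zero_left add_left scale_left)

lemma expand_left: "K f h = (\<Sum>a<r. f a * K (\<lambda>i. of_bool (i = a)) h)"
proof -
  have "K f h = K (\<lambda>i. \<Sum>a<r. f a * of_bool (i = a)) h"
    by (rule cong_left) (simp add: of_bool_def if_distrib cong: if_cong)
  then show ?thesis by (simp only: sum_left)
qed

lemma eigenvector:
  assumes "r > 0"
  shows "\<exists>u z. dot r u u = 1 \<and> (\<forall>g. K u g = z * dot r u g)"
proof -
  let ?S = "\<lambda>a b. K (\<lambda>i. of_bool (i = a)) (\<lambda>i. of_bool (i = b))"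
  obtain u z where u: "dot r u u = 1" "\<forall>i<r. (\<Sum>j<r. ?S i j * u j) = z * u i"
    using real_symmetric_eigenvector[OF assms, of ?S] commute unfolding dot_def by blast
  have "K u g = z * dot r u g" for g
  proof -
    have "K u g = K g u" by (rule commute)
    also have "\<dots> = (\<Sum>a<r. g a * K u (\<lambda>i. of_bool (i = a)))"
      by (subst expand_left) (simp add: commute)
    also have "\<dots> = (\<Sum>a<r. g a * (z * u a))"
    proof (intro sum.cong refl arg_cong2[where f = "(*)"])
      fix a assume "a \<in> {..<r}"
      then show "K u (\<lambda>i. of_bool (i = a)) = z * u a"
        using u(2) by (subst expand_left) (auto simp: commute mult.commute)
    qed
    finally show ?thesis by (simp add: dot_def sum_distrib_left mult_ac)
  qed
  then show ?thesis using u(1) by blast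
qed

end

text \<open>The operator \<open>I - s w w\<^sup>T\<close> is a reflection or, for \<open>s = 0\<close>, the identity. Conjugating a
  symmetric form by it splits off the eigenvector \<open>u\<close>.\<close>

lemma householder:
  assumes "dot (Suc r) u u = 1"
  obtains w s where "\<And>i. i \<le> r \<Longrightarrow> of_bool (i = 0) - s * w 0 * w i = u i"
    and "s * s * dot (Suc r) w w = 2 * s"
proof (cases "u 0 = 1")
  \<comment> \<open>A unit vector with first coordinate 1 is the first basis vector. No reflection
    is wanted here, and the \<open>s\<close> of the other case would divide by zero.\<close>
  case True
  have "(\<Sum>i<r. u (Suc i) * u (Suc i)) = 0"
    using assms True by (simp add: dot_def sum.lessThan_Suc_shift del: sum.lessThan_Suc)
  then have "\<forall>i<r. u (Suc i) = 0" by (subst (asm) sum_nonneg_eq_0_iff) auto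
  then have "of_bool (i = 0) - 0 * w 0 * w i = u i" if "i \<le> r" for i and w :: "nat \<Rightarrow> real"
    using True that by (cases i) auto
  then show thesis using that[of 0 "\<lambda>i. 0"] by simp
next
  case False
  \<comment> \<open>The reflection exchanging the first basis vector and \<open>u\<close> is along
    their difference, and \<open>1 / (1 - u 0)\<close> is 2 over the squared length of
    \<open>w\<close>.\<close>
  define w where "w = (\<lambda>i. of_bool (i = 0) - u i)"
  have "dot (Suc r) w w = 2 - 2 * u 0"
    unfolding w_def dot.diff_left dot.diff_right using assms by (simp add: dot_unit dot_unit')
  then have "1 / (1 - u 0) * (1 / (1 - u 0)) * dot (Suc r) w w = 2 * (1 / (1 - u 0))"
    using False by (simp add: divide_simps)
  moreover have "of_bool (i = 0) - 1 / (1 - u 0) * w 0 * w i = u i" for i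
    using False by (simp add: w_def)
  ultimately show thesis using that[of "1 / (1 - u 0)" w] by blast
qed

text \<open>Induction on the dimension. \<open>H\<close> is an orthogonal involution taking the
  first basis vector to \<open>u\<close>, so it takes vectors with first coordinate 0 to the
  complement of \<open>u\<close>. \<open>K'\<close> is the form compressed to that complement, and
  its eigenvectors are lifted by \<open>pad\<close> and \<open>H\<close>.\<close>

theorem spectral_theorem:
  assumes "sym_form r K"
  shows "\<exists>c z. (\<forall>k<r. \<forall>l<r. dot r (c k) (c l) = of_bool (k = l)) \<and>
    (\<forall>k<r. \<forall>g. K (c k) g = z k * dot r (c k) g)"
  using assms
proof (induction r arbitrary: K)
  case 0
  then show ?case by simp
next
  case (Suc r)
  let ?n = "Suc r"
  interpret K: sym_form ?n K by (rule Suc.prems)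
  obtain u z0 where u: "dot ?n u u = 1" "\<And>g. K u g = z0 * dot ?n u g"
    using K.eigenvector by blast
  obtain w s where w: "\<And>i. i \<le> r \<Longrightarrow> of_bool (i = 0) - s * w 0 * w i = u i"
    "s * s * dot ?n w w = 2 * s" by (rule householder[OF u(1)]) blast
  define H where "H = (\<lambda>x i. x i + (- s * dot ?n w x) * w i)"
  define pad :: "(nat \<Rightarrow> real) \<Rightarrow> nat \<Rightarrow> real" where "pad = (\<lambda>x i. case i of 0 \<Rightarrow> 0 | Suc j \<Rightarrow> x j)"
  let ?e = "\<lambda>i. of_bool (i = (0::nat)) :: real"
  have H_apply: "H x i = x i + (- s * dot ?n w x) * w i" for x i
    by (simp add: H_def)
  have H_add: "H (\<lambda>i. x i + y i) = (\<lambda>i. H x i + H y i)" for x y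
    by (simp add: H_def dot.add_right fun_eq_iff algebra_simps)
  have H_scale: "H (\<lambda>i. a * x i) = (\<lambda>i. a * H x i)" for a x
    by (simp add: H_def dot.scale_right fun_eq_iff algebra_simps)
  have H_cong: "H x i = H y i" if "\<And>i. i < ?n \<Longrightarrow> x i = y i" "i < ?n" for x y i
    using that dot_cong[of ?n w w x y] by (simp add: H_def)
  have H_sym: "dot ?n (H x) y = dot ?n x (H y)" for x y
    unfolding H_def dot.add_left dot.add_right dot.scale_left dot.scale_right
    using dot.commute[of ?n x w] by simp
  have HH: "H (H x) i = x i" for x i
  proof -
    have d: "dot ?n w (H x) = dot ?n w x - s * dot ?n w x * dot ?n w w"
      unfolding H_def dot.add_right dot.scale_right by simp
    have "H (H x) i = x i + (- s * dot ?n w x) * w i + (- s * dot ?n w (H x)) * w i"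
      using H_apply[of "H x" i] H_apply[of x i] by simp
    then have "H (H x) i = x i + (s * s * dot ?n w w - 2 * s) * dot ?n w x * w i"
      unfolding d by (simp add: algebra_simps)
    then show ?thesis by (simp add: w(2))
  qed
  have H_iso: "dot ?n (H x) (H y) = dot ?n x y" for x y
    unfolding H_sym HH by simp
  have He: "H ?e i = u i" if "i < ?n" for i
    using w(1)[of i] that by (simp add: H_def dot_unit)
  have pad_dot: "dot ?n (pad x) y = dot r x (\<lambda>i. y (Suc i))" for x y
    by (simp add: dot_def pad_def sum.lessThan_Suc_shift del: sum.lessThan_Suc)
  have pad_add: "pad (\<lambda>i. x i + y i) = (\<lambda>i. pad x i + pad y i)" for x y
    by (auto simp: pad_def split: nat.splits)
  have pad_scale: "pad (\<lambda>i. a * x i) = (\<lambda>i. a * pad x i)" for a x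
    by (auto simp: pad_def split: nat.splits)
  define K' where "K' = (\<lambda>f g. K (H (pad f)) (H (pad g)))"
  have "sym_form r K'"
  proof
    show "K' f g = K' g f" for f g unfolding K'_def by (rule K.commute)
    show "K' (\<lambda>i. f i + g i) h = K' f h + K' g h" for f g h
      unfolding K'_def pad_add H_add K.add_left ..
    show "K' (\<lambda>i. c * f i) h = c * K' f h" for c f h
      unfolding K'_def pad_scale H_scale K.scale_left ..
    show "K' f h = K' f' h" if "\<And>i. i < r \<Longrightarrow> f i = f' i" for f f' h
      unfolding K'_def using that
      by (intro K.cong_left H_cong) (auto simp: pad_def split: nat.splits)
  qed
  then obtain c z where c: "\<forall>k<r. \<forall>l<r. dot r (c k) (c l) = of_bool (k = l)"
    "\<forall>k<r. \<forall>g. K' (c k) g = z k * dot r (c k) g" using Suc.IH by blast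
  define c' where "c' = (\<lambda>k. case k of 0 \<Rightarrow> u | Suc l \<Rightarrow> H (pad (c l)))"
  define z' where "z' = (\<lambda>k. case k of 0 \<Rightarrow> z0 | Suc l \<Rightarrow> z l)"
  have u_perp: "dot ?n u (H (pad x)) = 0" for x
  proof -
    have "dot ?n u (H (pad x)) = dot ?n (H ?e) (H (pad x))" using He by (intro dot_cong) auto
    then show ?thesis by (simp add: H_iso dot_unit' pad_def)
  qed
  have orth: "dot ?n (c' k) (c' l) = of_bool (k = l)" if "k < ?n" "l < ?n" for k l
  proof -
    have pp: "dot ?n (pad x) (pad y) = dot r x y" for x y
      unfolding pad_dot by (simp add: pad_def)
    have "dot ?n (H (pad x)) u = 0" for x using u_perp dot.commute by metis
    with pp show ?thesis
      using that c(1) u(1) u_perp by (cases k; cases l) (simp_all add: c'_def H_iso)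
  qed
  have eig: "K (c' k) g = z' k * dot ?n (c' k) g" if k: "k < ?n" for k g
  proof (cases k)
    case 0
    then show ?thesis using u(2) by (simp add: c'_def z'_def)
  next
    case (Suc l)
    let ?t = "\<lambda>i. H g (Suc i)" and ?x = "H (pad (c l))"
    \<comment> \<open>Since \<open>g\<close> is \<open>H (H g)\<close>, splitting \<open>H g\<close>
      at coordinate 0 separates the component of \<open>g\<close> along \<open>u\<close>, which
      \<open>K\<close> pairs to zero with the lifted eigenvector, from the part governed by
      \<open>K'\<close>.\<close>
    have split: "H g i = H g 0 * ?e i + pad ?t i" for i by (simp add: pad_def split: nat.splits)
    have "K ?x g = K ?x (H (H g))" by (simp add: HH[THEN ext])
    also have "H (H g) = (\<lambda>i. H g 0 * H ?e i + H (pad ?t) i)"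
      using arg_cong[OF ext[OF split], of H] unfolding H_add H_scale .
    also have "K ?x \<dots> = H g 0 * K ?x (H ?e) + K ?x (H (pad ?t))"
      unfolding K.add_right K.scale_right ..
    also have "K ?x (H ?e) = K u ?x" using He by (subst K.commute, intro K.cong_left) auto
    also have "K u ?x = 0" using u(2) u_perp by simp
    also have "K ?x (H (pad ?t)) = z l * dot r (c l) ?t"
      using c(2) Suc k unfolding K'_def by auto
    finally show ?thesis using Suc by (simp add: c'_def z'_def H_sym pad_dot)
  qed
  show ?case using orth eig by blast
qed

subsection \<open>Invertible extensions of a truncated shift\<close>

text \<open>A nonzero vector orthogonal to all \<open>c k\<close> could be normalised and would give
  \<open>r + 1\<close> orthonormal vectors in dimension \<open>r\<close>.\<close>

lemma dot_complete:
  assumes c: "\<And>k l. k < r \<Longrightarrow> l < r \<Longrightarrow> dot r (c k) (c l) = of_bool (k = l)"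
    and f: "\<And>k. k < r \<Longrightarrow> dot r f (c k) = 0"
  shows "dot r f f = 0"
proof (rule ccontr)
  assume "dot r f f \<noteq> 0"
  then have pos: "dot r f f > 0" using dot.nonneg[of r f] by simp
  define s where "s = 1 / sqrt (dot r f f)"
  define c' where "c' = c(r := (\<lambda>i. s * f i))"
  have "s * s * dot r f f = 1" using pos by (simp add: s_def)
  then have "dot r (c' k) (c' l) = of_bool (k = l)" if "k < Suc r" "l < Suc r" for k l
    using that c f dot.commute[of r "c _" f]
    by (auto simp: c'_def dot.scale_left dot.scale_right less_Suc_eq)
  then have "Suc r \<le> r" by (rule orthonormal_card_le)
  then show False by simp
qed

text \<open>\<open>sh_null\<close> is what makes the shift well defined on classes. In the
  application the domain is proper, because multiplication by \<open>x - t\<close> raises the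
  degree; symmetry is therefore asked only for pairs of vectors in the domain.\<close>

locale truncated_shift = semi_inner B for B +
  fixes m N :: nat and sh :: "(nat \<Rightarrow> real) \<Rightarrow> nat \<Rightarrow> real"
  assumes m_le_N: "m \<le> N"
    and sh_add: "sh (\<lambda>i. f i + g i) = (\<lambda>i. sh f i + sh g i)"
    and sh_scale: "sh (\<lambda>i. c * f i) = (\<lambda>i. c * sh f i)"
    and sh_supported: "f \<in> supported_below m \<Longrightarrow> sh f \<in> supported_below N"
    and sh_symmetric: "f \<in> supported_below m \<Longrightarrow> g \<in> supported_below m \<Longrightarrow> B (sh f) g = B f (sh g)"
    and sh_null: "f \<in> supported_below m \<Longrightarrow> B f f = 0 \<Longrightarrow> B (sh f) (sh f) = 0"
begin

text \<open>The shift is a symmetric operator on the classes of \<open>supported_below m\<close> modulo null vectors.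
  Its self-adjoint extensions with scalar corner \<open>l\<close> on the orthogonal complement have form \<open>K l\<close>.
  Kernel vectors for distinct \<open>l\<close> have nonzero, pairwise orthogonal components in the complement,
  so all but finitely many \<open>l\<close> give an invertible extension.\<close>

theorem invertible_extension:
  assumes inj: "\<And>f. f \<in> supported_below m \<Longrightarrow> B (sh f) (sh f) = 0 \<Longrightarrow> B f f = 0"
  shows "\<exists>es z. orthonormal es \<and> set es \<subseteq> supported_below N \<and> complete_below N es \<and>
    (\<forall>k<length es. z k \<noteq> 0 \<and> (\<forall>f\<in>supported_below m. B (sh f) (es ! k) = z k * B f (es ! k)))"
proof -
  obtain qs where qs: "orthonormal qs" "set qs \<subseteq> supported_below m" "complete_below m qs"
    using gram_schmidt[OF orthonormal_Nil _ complete_below_0, of m] by auto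
  obtain qs' where qs': "orthonormal (qs @ qs')" "set (qs @ qs') \<subseteq> supported_below N"
    "complete_below N (qs @ qs')"
    using gram_schmidt[OF qs, of "N - m"] m_le_N by auto
  define Q where "Q = (\<lambda>a. (qs @ qs') ! a)"
  define s where "s = length qs"
  define r where "r = length (qs @ qs')"
  have sr: "s \<le> r" by (simp add: s_def r_def)
  define E where "E = (\<lambda>c i. \<Sum>a<r. c a * Q a i)"
  define P where "P = (\<lambda>c i. \<Sum>a<s. c a * Q a i)"
  define tail where "tail = (\<lambda>c a. c (s + a) :: real)"
  \<comment> \<open>Block form of an extension: the first two terms prescribe the shift on the
    domain and, by symmetry, the mixed blocks. They count the domain block twice, hence the
    subtraction. The last term is the free corner.\<close>
  define K where "K = (\<lambda>l f g. B (sh (P f)) (E g) + B (E f) (sh (P g)) - B (sh (P f)) (P g)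
    + l * dot (r - s) (tail f) (tail g))"
  have Q: "B (Q a) (Q b) = of_bool (a = b)" if "a < r" "b < r" for a b
    using qs'(1) that by (simp add: orthonormal_def Q_def r_def)
  have Q_supp: "Q a \<in> supported_below N" if "a < r" for a
    using qs'(2) nth_mem[of a "qs @ qs'"] that unfolding Q_def r_def by blast
  have Q_supp': "Q a \<in> supported_below m" if "a < s" for a
    using qs(2) nth_mem[of a "qs"] that unfolding Q_def s_def nth_append by auto
  have P_supp: "P c \<in> supported_below m" for c
    unfolding P_def by (intro supported_below_sum Q_supp') simp
  have E_supp: "E c \<in> supported_below N" for c
    unfolding E_def by (intro supported_below_sum Q_supp) simp
  have E_add: "E (\<lambda>i. f i + g i) = (\<lambda>i. E f i + E g i)" for f g
    by (simp add: E_def distrib_right sum.distrib)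
  have P_add: "P (\<lambda>i. f i + g i) = (\<lambda>i. P f i + P g i)" for f g
    by (simp add: P_def distrib_right sum.distrib)
  have E_scale: "E (\<lambda>i. c * f i) = (\<lambda>i. c * E f i)" for c f
    by (simp add: E_def sum_distrib_left mult.assoc)
  have P_scale: "P (\<lambda>i. c * f i) = (\<lambda>i. c * P f i)" for c f
    by (simp add: P_def sum_distrib_left mult.assoc)
  have E_cong: "E f = E g" if "\<And>i. i < r \<Longrightarrow> f i = g i" for f g
    using that by (simp add: E_def)
  have P_cong: "P f = P g" if "\<And>i. i < r \<Longrightarrow> f i = g i" for f g
    using that sr by (simp add: P_def)
  have tail_add: "tail (\<lambda>i. f i + g i) = (\<lambda>i. tail f i + tail g i)" for f g
    by (simp add: tail_def)
  have tail_scale: "tail (\<lambda>i. c * f i) = (\<lambda>i. c * tail f i)" for c f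
    by (simp add: tail_def)
  have QE: "B (Q a) (E c) = c a" if "a < r" for a c
  proof -
    have "B (Q a) (E c) = (\<Sum>b<r. c b * of_bool (a = b))"
      unfolding E_def sum_right using Q that by (intro sum.cong) auto
    also have "\<dots> = c a" using that by (simp add: of_bool_def if_distrib cong: if_cong)
    finally show ?thesis .
  qed
  have EE: "B (E c) (E d) = dot r c d" for c d
    by (subst E_def, subst sum_left) (simp add: QE dot_def)
  have PE: "P c = E c" if "\<And>a. s \<le> a \<Longrightarrow> a < r \<Longrightarrow> c a = 0" for c
  proof -
    have "(\<Sum>a<s. c a * Q a i) = (\<Sum>a<r. c a * Q a i)" for i
      using sr that by (intro sum.mono_neutral_left) auto
    then show ?thesis by (simp add: P_def E_def)
  qed
  have K_form: "sym_form r (K l)" for l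
  proof
    show "K l f g = K l g f" for f g
      unfolding K_def using sh_symmetric[OF P_supp P_supp, of f g] commute dot.commute by fastforce
    show "K l (\<lambda>i. f i + g i) h = K l f h + K l g h" for f g h
      unfolding K_def P_add E_add tail_add sh_add add_left dot.add_left by (simp add: distrib_left)
    show "K l (\<lambda>i. c * f i) h = c * K l f h" for c f h
      unfolding K_def P_scale E_scale tail_scale sh_scale scale_left dot.scale_left
      by (simp add: algebra_simps)
    show "K l f h = K l f' h" if "\<And>i. i < r \<Longrightarrow> f i = f' i" for f f' h
      unfolding K_def using that E_cong[of f f'] P_cong[of f f']
        dot_cong[of "r - s" "tail f" "tail f'" "tail h" "tail h"] by (simp add: tail_def)
  qed
  \<comment> \<open>On a vector of the domain the corner vanishes and the second and third terms
    cancel by symmetry, so the form is the shift itself for every \<open>l\<close>.\<close>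
  have K_head: "K l c g = B (sh (P c)) (E g)" if "\<And>a. s \<le> a \<Longrightarrow> a < r \<Longrightarrow> c a = 0" for l c g
  proof -
    have "dot (r - s) (tail c) (tail g) = 0" using that by (simp add: dot_def tail_def)
    then show ?thesis
      unfolding K_def using PE[OF that] sh_symmetric[OF P_supp P_supp, of c g] by simp
  qed
  define bad where "bad = (\<lambda>l c. dot r c c = 1 \<and> (\<forall>g. K l c g = 0))"
  \<comment> \<open>A kernel vector with zero tail would lie in the domain, and its shift, being
    orthogonal to the full basis, would be null, against \<open>inj\<close>.\<close>
  have tail_nz: "dot (r - s) (tail c) (tail c) > 0" if bad: "bad l c" for l c
  proof (rule ccontr)
    assume "\<not> ?thesis"
    then have "dot (r - s) (tail c) (tail c) = 0" using dot.nonneg[of "r - s" "tail c"] by linarith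
    then have "\<forall>a<r - s. tail c a = 0" unfolding dot_def
      by (subst (asm) sum_nonneg_eq_0_iff) auto
    then have z: "c a = 0" if "s \<le> a" "a < r" for a
      using that by (metis tail_def le_add_diff_inverse diff_less_mono)
    have "B (sh (P c)) (Q b) = 0" if "b < r" for b
    proof -
      have "E (\<lambda>j. of_bool (j = b)) = Q b"
        using that by (simp add: E_def of_bool_def if_distrib[of "\<lambda>x. x * _"] cong: if_cong)
      moreover have "K l c g = B (sh (P c)) (E g)" for g by (rule K_head) (rule z)
      ultimately show ?thesis using bad unfolding bad_def by metis
    qed
    then have "\<forall>q\<in>set (qs @ qs'). B (sh (P c)) q = 0"
      unfolding Q_def r_def by (metis in_set_conv_nth)
    then have "B (sh (P c)) (sh (P c)) = 0"
      using qs'(3) sh_supported[OF P_supp] unfolding complete_below_def by blast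
    then have "B (P c) (P c) = 0" by (rule inj[OF P_supp])
    moreover have "B (P c) (P c) = 1"
      using bad PE[OF z] EE by (simp add: bad_def)
    ultimately show False by simp
  qed
  have "\<exists>l. \<forall>c. \<not> bad l c"
  proof (rule ccontr)
    assume "\<not> ?thesis"
    then have "\<forall>i. \<exists>c. bad (real i) c" by blast
    then obtain c where c: "\<And>i. bad (real i) (c i)" by metis
    define v where "v = (\<lambda>i a. (1 / sqrt (dot (r - s) (tail (c i)) (tail (c i)))) * tail (c i) a)"
    have "dot (r - s) (v i) (v j) = of_bool (i = j)" for i j
    proof (cases "i = j")
      case True
      have "dot (r - s) (v i) (v i) = 1"
        proof -
        define t where "t = dot (r - s) (tail (c i)) (tail (c i))"
        have "t > 0" unfolding t_def by (rule tail_nz[OF c])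
        then show ?thesis unfolding v_def dot.scale_left dot.scale_right t_def[symmetric] by simp
      qed
      then show ?thesis using True by simp
    next
      case False
      \<comment> \<open>The two kernel equations concern the same pair of vectors and differ only in
        the corner. Their difference is \<open>real i - real j\<close> times the pairing of the
        tails.\<close>
      have "K (real i) (c i) (c j) = 0" "K (real j) (c j) (c i) = 0"
        using c unfolding bad_def by blast+
      then have "K (real i) (c i) (c j) - K (real j) (c i) (c j) = 0"
        using sym_form.commute[OF K_form, of "real j" "c j" "c i"] by simp
      then have "(real i - real j) * dot (r - s) (tail (c i)) (tail (c j)) = 0"
        unfolding K_def by (simp add: algebra_simps)
      then have "dot (r - s) (tail (c i)) (tail (c j)) = 0" using False by simp
      then show ?thesis
        unfolding v_def dot.scale_left dot.scale_right using False by simp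
    qed
    \<comment> \<open>The tails live in dimension \<open>r - s\<close>, so one more orthonormal tail
      than that is already impossible.\<close>
    then have "Suc (r - s) \<le> r - s" by (intro orthonormal_card_le[where v = v]) auto
    then show False by simp
  qed
  then obtain l where l: "\<And>c. \<not> bad l c" by blast
  obtain c z where c: "\<forall>k<r. \<forall>l<r. dot r (c k) (c l) = of_bool (k = l)"
    "\<forall>k<r. \<forall>g. K l (c k) g = z k * dot r (c k) g"
    using spectral_theorem[OF K_form[of l]] by blast
  define es where "es = map (\<lambda>k. E (c k)) [0..<r]"
  have es: "length es = r" "\<And>k. k < r \<Longrightarrow> es ! k = E (c k)" by (simp_all add: es_def)
  have "orthonormal es"
    unfolding orthonormal_def es(1) using es(2) EE c(1) by simp
  moreover have "set es \<subseteq> supported_below N"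
    unfolding es_def using E_supp by auto
  moreover have "complete_below N es"
    unfolding complete_below_def
  proof (intro ballI impI)
    fix f assume f: "f \<in> supported_below N" "\<forall>e\<in>set es. B f e = 0"
    \<comment> \<open>In these coordinates, orthogonality to \<open>es\<close> becomes orthogonality
      to the full orthonormal system \<open>c\<close>, so \<open>f\<close> is orthogonal to the
      original basis as well.\<close>
    let ?\<phi> = "\<lambda>a. B f (Q a)"
    have BfE: "B f (E d) = dot r ?\<phi> d" for d
      unfolding E_def sum_right by (simp add: dot_def mult.commute)
    have "dot r ?\<phi> (c k) = 0" if "k < r" for k
      using f(2) that BfE es by (metis nth_mem)
    then have "dot r ?\<phi> ?\<phi> = 0" using c(1) by (intro dot_complete[of r c]) auto
    then have "\<forall>a<r. ?\<phi> a = 0" unfolding dot_def by (subst (asm) sum_nonneg_eq_0_iff) auto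
    then have "\<forall>q\<in>set (qs @ qs'). B f q = 0"
      unfolding Q_def r_def by (metis in_set_conv_nth)
    then show "B f f = 0" using qs'(3) f(1) unfolding complete_below_def by blast
  qed
  moreover have "z k \<noteq> 0" if k: "k < r" for k
  proof
    assume "z k = 0"
    then have "bad l (c k)" using c k unfolding bad_def by simp
    then show False using l by blast
  qed
  moreover have "B (sh f) (E (c k)) = z k * B f (E (c k))"
    if k: "k < r" and f: "f \<in> supported_below m" for k f
  proof -
    \<comment> \<open>\<open>f\<close> differs from the combination \<open>P \<phi>\<close> of basis
      vectors of the domain by a null vector \<open>d\<close>, whose shift is null by
      \<open>sh_null\<close>. Both sides can be computed at \<open>P \<phi>\<close>, where
      \<open>K_head\<close> applies.\<close>
    define \<phi> where "\<phi> = (\<lambda>a. if a < s then B f (Q a) else 0)"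
    have \<phi>: "\<phi> a = 0" if "s \<le> a" "a < r" for a using that by (simp add: \<phi>_def)
    have P\<phi>: "P \<phi> = E \<phi>" by (rule PE) (rule \<phi>)
    define d where "d = (\<lambda>i. f i + (-1) * P \<phi> i)"
    have "d = (\<lambda>i. f i - (\<Sum>a<length qs. B f (qs ! a) * (qs ! a) i))"
      unfolding d_def P_def \<phi>_def s_def Q_def by (auto simp: fun_eq_iff nth_append intro!: sum.cong)
    then have d0: "B d d = 0" using fourier_left[OF qs f] by simp
    have d_supp: "d \<in> supported_below m"
      using f P_supp[of \<phi>] by (auto simp: d_def supported_below_def)
    have "B (sh d) h = 0" for h by (rule null_orthogonal[OF sh_null[OF d_supp d0]])
    then have 1: "B (sh f) h = B (sh (P \<phi>)) h" for h
      unfolding d_def sh_add sh_scale add_left scale_left by simp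
    have "B d h = 0" for h by (rule null_orthogonal[OF d0])
    then have 2: "B f h = B (P \<phi>) h" for h
      unfolding d_def add_left scale_left by simp
    have "B (sh f) (E (c k)) = K l \<phi> (c k)"
      unfolding 1 by (rule K_head[symmetric]) (rule \<phi>)
    also have "\<dots> = K l (c k) \<phi>" by (rule sym_form.commute[OF K_form])
    also have "\<dots> = z k * dot r (c k) \<phi>" using c(2) k by blast
    also have "dot r (c k) \<phi> = B f (E (c k))"
      unfolding 2 P\<phi> EE by (rule dot.commute)
    finally show ?thesis .
  qed
  ultimately show ?thesis using es by (intro exI[of _ es] exI[of _ z]) simp
qed

end

subsection \<open>Integration against signed measures with a density\<close>

lemma measure_of_borel_eqI:
  fixes M :: "'a::topological_space measure"
  assumes "sets M = sets borel" "\<And>B. B \<in> sets borel \<Longrightarrow> g B = emeasure M B"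
  shows "measure_of UNIV (sets borel) g = M"
proof -
  have "space M = UNIV" using sets_eq_imp_space_eq[OF assms(1)] by simp
  then have "measure_of UNIV (sets borel) (emeasure M) = M"
    using measure_of_of_measure[of M] assms(1) by simp
  moreover have "measure_of UNIV (sets borel) g = measure_of UNIV (sets borel) (emeasure M)"
    using sets.sigma_sets_eq[of borel] assms(2) by (intro measure_of_eq) auto
  ultimately show ?thesis by simp
qed

lemma signed_borel_measure_emeasure:
  assumes "signed_borel_measure \<nu>" "\<And>B. B \<in> sets borel \<Longrightarrow> \<nu> B \<ge> 0" "B \<in> sets borel"
  shows "emeasure (measure_of UNIV (sets borel) (\<lambda>B. ennreal (\<nu> B))) B = ennreal (\<nu> B)"
proof (rule emeasure_measure_of[OF refl])
  show "sets borel \<subseteq> Pow (UNIV :: real set)" by simp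
  have eq: "sets (measure_of UNIV (sets borel) (\<lambda>B. ennreal (\<nu> B))) = sets (borel :: real measure)"
    using sets.sigma_sets_eq[of "borel :: real measure"] by (simp add: sets_measure_of)
  then show "B \<in> sets (measure_of UNIV (sets borel) (\<lambda>B. ennreal (\<nu> B)))" using assms(3) by simp
  show "positive (sets (measure_of UNIV (sets borel) (\<lambda>B. ennreal (\<nu> B)))) (\<lambda>B. ennreal (\<nu> B))"
    using assms(1) by (simp add: positive_def signed_borel_measure_def)
  show "countably_additive (sets (measure_of UNIV (sets borel) (\<lambda>B. ennreal (\<nu> B)))) (\<lambda>B. ennreal (\<nu> B))"
    unfolding countably_additive_def eq
  proof (intro allI impI)
    fix A :: "nat \<Rightarrow> real set" assume A: "range A \<subseteq> sets borel" "disjoint_family A"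
    then have "(\<lambda>k. \<nu> (A k)) sums \<nu> (\<Union>k. A k)"
      using assms(1) unfolding signed_borel_measure_def by blast
    then show "(\<Sum>i. ennreal (\<nu> (A i))) = ennreal (\<nu> (\<Union> (range A)))"
      using suminf_ennreal2[of "\<lambda>i. \<nu> (A i)"] assms(2) rangeI[of A] A(1)
      by (metis sums_iff subsetD)
  qed
qed

text \<open>The set where \<open>h\<close> is negative is itself a test set, and there the integral
  cannot be nonnegative unless it vanishes.\<close>

lemma AE_nonneg_of_set_integral:
  fixes h :: "'a \<Rightarrow> real"
  assumes h: "integrable M h" and pos: "\<And>B. B \<in> sets M \<Longrightarrow> (\<integral>x. indicator B x * h x \<partial>M) \<ge> 0"
  shows "AE x in M. h x \<ge> 0"
proof -
  have [measurable]: "h \<in> borel_measurable M" using h by simp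
  define B where "B = {x \<in> space M. h x < 0}"
  have B[measurable]: "B \<in> sets M" unfolding B_def by measurable
  have int: "integrable M (\<lambda>x. - (indicator B x * h x))"
    using integrable_mult_indicator[OF B h] by simp
  have nn: "AE x in M. 0 \<le> - (indicator B x * h x)"
    by (rule AE_I2) (auto simp: B_def indicator_def)
  have "0 \<le> (\<integral>x. - (indicator B x * h x) \<partial>M)" by (rule integral_nonneg_AE[OF nn])
  then have "(\<integral>x. - (indicator B x * h x) \<partial>M) = 0" using pos[OF B] by simp
  then have "AE x in M. - (indicator B x * h x) = 0"
    using integral_nonneg_eq_0_iff_AE[OF int nn] by simp
  then show ?thesis
    by (rule AE_mp) (rule AE_I2, auto simp: B_def indicator_def split: if_splits)
qed

text \<open>The Hahn decomposition is read off the density: the supremum is attained on the part of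
  \<open>B\<close> where \<open>w\<close> is nonnegative. Since \<open>ennreal\<close> sends
  negative values to 0, the measure on the right has density the positive part of
  \<open>w\<close>.\<close>

lemma upper_variation_density:
  assumes sets: "sets M = sets borel" and w: "integrable M w"
    and \<nu>: "\<And>B. B \<in> sets borel \<Longrightarrow> \<nu> B = (\<integral>x. indicator B x * w x \<partial>M)"
  shows "upper_variation \<nu> = density M (\<lambda>x. ennreal (w x))"
  unfolding upper_variation_def
proof (rule measure_of_borel_eqI)
  have [measurable]: "w \<in> borel_measurable M" using w by simp
  show "sets (density M (\<lambda>x. ennreal (w x))) = sets borel" using sets by simp
  fix B :: "real set" assume B: "B \<in> sets borel"
  then have [measurable]: "B \<in> sets M" using sets by simp
  have space: "space M = UNIV" using sets_eq_imp_space_eq[OF sets] by simp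
  have ind: "integrable M (\<lambda>x. indicator C x * w x)" if "C \<in> sets borel" for C
    using integrable_mult_indicator[of C M w] that w sets by simp
  have e: "emeasure (density M (\<lambda>x. ennreal (w x))) B = (\<integral>\<^sup>+x. ennreal (w x) * indicator B x \<partial>M)"
    by (rule emeasure_density) auto
  show "(SUP C\<in>{C \<in> sets borel. C \<subseteq> B}. ennreal (\<nu> C)) = emeasure (density M (\<lambda>x. ennreal (w x))) B"
  proof (rule antisym)
    show "(SUP C\<in>{C \<in> sets borel. C \<subseteq> B}. ennreal (\<nu> C)) \<le> emeasure (density M (\<lambda>x. ennreal (w x))) B"
    proof (rule SUP_least)
      fix C assume C: "C \<in> {C \<in> sets borel. C \<subseteq> B}"
      then have Cm[measurable]: "C \<in> sets M" using sets by simp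
      define g where "g = (\<lambda>x. indicator C x * max 0 (w x))"
      have gi: "integrable M g"
        unfolding g_def using integrable_mult_indicator[OF Cm integrable_max[OF _ w, of "\<lambda>x. 0"]] by simp
      have "\<nu> C \<le> (\<integral>x. g x \<partial>M)"
        unfolding \<nu>[OF C[THEN CollectD, THEN conjunct1]] using C gi ind
        by (intro integral_mono) (auto simp: g_def indicator_def)
      then have "ennreal (\<nu> C) \<le> ennreal (\<integral>x. g x \<partial>M)" by (rule ennreal_leI)
      also have "\<dots> = (\<integral>\<^sup>+x. ennreal (g x) \<partial>M)"
        using gi by (intro nn_integral_eq_integral[symmetric]) (auto simp: g_def)
      also have "\<dots> \<le> (\<integral>\<^sup>+x. ennreal (w x) * indicator B x \<partial>M)"
        using C by (intro nn_integral_mono) (auto simp: g_def indicator_def max_def ennreal_neg)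
      finally show "ennreal (\<nu> C) \<le> emeasure (density M (\<lambda>x. ennreal (w x))) B" unfolding e .
    qed
    define C where "C = B \<inter> {x \<in> space M. w x \<ge> 0}"
    have "C \<in> sets M" unfolding C_def by measurable
    then have C: "C \<in> {C \<in> sets borel. C \<subseteq> B}" using sets by (auto simp: C_def)
    have "(\<integral>\<^sup>+x. ennreal (w x) * indicator B x \<partial>M) = (\<integral>\<^sup>+x. ennreal (indicator C x * w x) \<partial>M)"
      by (intro nn_integral_cong) (auto simp: C_def indicator_def ennreal_neg)
    also have "\<dots> = ennreal (\<integral>x. indicator C x * w x \<partial>M)"
    proof (rule nn_integral_eq_integral)
      show "integrable M (\<lambda>x. indicator C x * w x)" using ind C by simp
      show "AE x in M. 0 \<le> indicator C x * w x" by (rule AE_I2) (auto simp: C_def indicator_def)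
    qed
    also have "\<dots> = ennreal (\<nu> C)" using \<nu> C by simp
    also have "\<dots> \<le> (SUP C\<in>{C \<in> sets borel. C \<subseteq> B}. ennreal (\<nu> C))"
      using C by (rule SUP_upper)
    finally show "emeasure (density M (\<lambda>x. ennreal (w x))) B \<le> (SUP C\<in>{C \<in> sets borel. C \<subseteq> B}. ennreal (\<nu> C))"
      unfolding e .
  qed
qed

text \<open>The upper variations of \<open>\<nu>\<close> and of its negative have the positive parts
  of \<open>w\<close> and \<open>- w\<close> as densities, and \<open>w\<close> is their difference.
  Integrals defined through variations thus become ordinary ones.\<close>

lemma signed_integral_density:
  assumes sets: "sets M = sets borel" and w: "integrable M w"
    and \<nu>: "\<And>B. B \<in> sets borel \<Longrightarrow> \<nu> B = (\<integral>x. indicator B x * w x \<partial>M)"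
    and f: "f \<in> borel_measurable borel" and fw: "integrable M (\<lambda>x. f x * w x)"
  shows "signed_integral \<nu> f = (\<integral>x. f x * w x \<partial>M)"
proof -
  have wm[measurable]: "w \<in> borel_measurable M" using w by simp
  have fm[measurable]: "f \<in> borel_measurable M" using f sets measurable_cong_sets by blast
  \<comment> \<open>Stated for every \<open>v\<close> with the absolute value of \<open>w\<close>,
    in order to serve both \<open>w\<close> and \<open>- w\<close>.\<close>
  have max: "integrable M (\<lambda>x. max 0 (v x) * f x)" and
    part: "integral\<^sup>L (density M (\<lambda>x. ennreal (v x))) f = (\<integral>x. max 0 (v x) * f x \<partial>M)"
    if [measurable]: "v \<in> borel_measurable M" and v: "\<And>x. \<bar>v x\<bar> = \<bar>w x\<bar>" for v
  proof -
    show "integrable M (\<lambda>x. max 0 (v x) * f x)"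
    proof (rule Bochner_Integration.integrable_bound[OF fw])
      have "\<bar>max 0 (v x)\<bar> \<le> \<bar>w x\<bar>" for x using v[of x] by linarith
      then show "AE x in M. norm (max 0 (v x) * f x) \<le> norm (f x * w x)"
        by (auto simp: abs_mult mult.commute intro!: AE_I2 mult_left_mono)
    qed measurable
    have "density M (\<lambda>x. ennreal (v x)) = density M (\<lambda>x. ennreal (max 0 (v x)))"
      by (intro density_cong) (auto simp: max_def ennreal_neg)
    then show "integral\<^sup>L (density M (\<lambda>x. ennreal (v x))) f = (\<integral>x. max 0 (v x) * f x \<partial>M)"
      by (simp add: integral_density)
  qed
  have "upper_variation \<nu> = density M (\<lambda>x. ennreal (w x))"
    by (rule upper_variation_density[OF sets w \<nu>])
  moreover have "upper_variation (\<lambda>B. - \<nu> B) = density M (\<lambda>x. ennreal (- w x))"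
    by (rule upper_variation_density[OF sets]) (simp_all add: w \<nu>)
  ultimately have "signed_integral \<nu> f = (\<integral>x. max 0 (w x) * f x \<partial>M) - (\<integral>x. max 0 (- w x) * f x \<partial>M)"
    unfolding signed_integral_def using part[of w] part[of "\<lambda>x. - w x"] by simp
  also have "\<dots> = (\<integral>x. max 0 (w x) * f x - max 0 (- w x) * f x \<partial>M)"
    using max[of w] max[of "\<lambda>x. - w x"] by (intro Bochner_Integration.integral_diff[symmetric]) auto
  also have "\<dots> = (\<integral>x. f x * w x \<partial>M)"
    by (intro Bochner_Integration.integral_cong) (auto simp: max_def)
  finally show ?thesis .
qed

subsection \<open>Positive matrix measures\<close>

lemma psd_iff:
  "psd p A \<longleftrightarrow> A \<in> carrier_mat p p \<and> (\<forall>i<p. \<forall>j<p. A $$ (i, j) = A $$ (j, i)) \<and>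
     (\<forall>v. (\<Sum>i<p. \<Sum>j<p. v i * v j * A $$ (i, j)) \<ge> 0)"
proof (cases "A \<in> carrier_mat p p")
  case True
  have sym: "A\<^sup>T = A \<longleftrightarrow> (\<forall>i<p. \<forall>j<p. A $$ (i, j) = A $$ (j, i))"
    using True by (auto intro!: eq_matI) (metis carrier_matD index_transpose_mat(1))
  have quad: "scalar_prod v (A *\<^sub>v v) = (\<Sum>i<p. \<Sum>j<p. v $ i * v $ j * A $$ (i, j))"
    if "v \<in> carrier_vec p" for v
    using True that by (simp add: scalar_prod_def atLeast0LessThan sum_distrib_left mult_ac)
  have "(\<forall>v\<in>carrier_vec p. scalar_prod v (A *\<^sub>v v) \<ge> 0) \<longleftrightarrow>
        (\<forall>v. (\<Sum>i<p. \<Sum>j<p. v i * v j * A $$ (i, j)) \<ge> 0)"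
  proof (intro iffI allI ballI)
    fix v assume "\<forall>v\<in>carrier_vec p. scalar_prod v (A *\<^sub>v v) \<ge> 0"
    then have "scalar_prod (vec p v) (A *\<^sub>v vec p v) \<ge> 0" by simp
    then show "(\<Sum>i<p. \<Sum>j<p. v i * v j * A $$ (i, j)) \<ge> 0" by (simp add: quad)
  next
    fix v :: "real vec"
    assume "\<forall>v. (\<Sum>i<p. \<Sum>j<p. v i * v j * A $$ (i, j)) \<ge> 0" "v \<in> carrier_vec p"
    then show "scalar_prod v (A *\<^sub>v v) \<ge> 0" using quad by simp
  qed
  then show ?thesis using True sym by (simp add: psd_def sym_mats_def)
qed (auto simp: psd_def sym_mats_def)

lemma psd_quadratic: "psd p A \<Longrightarrow> (\<Sum>i<p. \<Sum>j<p. v i * v j * A $$ (i, j)) \<ge> 0"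
  unfolding psd_iff by simp

text \<open>The test vector is the unit vector at \<open>i\<close> plus \<open>s\<close> times that
  at \<open>j\<close>. The case \<open>i = j\<close> is included and yields nonnegativity of the
  diagonal.\<close>

lemma psd_two_indices:
  assumes A: "psd p A" and ij: "i < p" "j < p"
  shows "A $$ (i, i) + 2 * s * A $$ (i, j) + s * s * A $$ (j, j) \<ge> 0"
proof -
  have row: "(\<Sum>b<p. (of_bool (b = i) + s * of_bool (b = j)) * f b) = f i + s * f j" for f :: "nat \<Rightarrow> real"
    using ij by (simp add: of_bool_def distrib_right sum.distrib if_distrib[of "\<lambda>x. x * _"]
      if_distrib[of "\<lambda>x. _ * x"] cong: if_cong)
  let ?v = "\<lambda>a. of_bool (a = i) + s * of_bool (a = j)"
  have "0 \<le> (\<Sum>a<p. \<Sum>b<p. ?v a * ?v b * A $$ (a, b))" by (rule psd_quadratic[OF A])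
  also have "\<dots> = (\<Sum>a<p. ?v a * (\<Sum>b<p. ?v b * A $$ (a, b)))"
    by (simp only: sum_distrib_left mult.assoc)
  also have "\<dots> = A $$ (i, i) + s * A $$ (i, j) + s * (A $$ (j, i) + s * A $$ (j, j))"
    unfolding row ..
  also have "A $$ (j, i) = A $$ (i, j)" using A ij unfolding psd_iff by blast
  finally show ?thesis by (simp add: algebra_simps)
qed

lemma psd_diag_nonneg: "psd p A \<Longrightarrow> i < p \<Longrightarrow> A $$ (i, i) \<ge> 0"
  using psd_two_indices[of p A i i 0] by simp

text \<open>The choices \<open>s = 1\<close> and \<open>s = -1\<close> bound an off-diagonal entry
  by the mean of two diagonal ones. For a matrix measure this puts every entry under the trace
  measure.\<close>

lemma psd_abs_le_trace:
  assumes A: "psd p A" and ij: "i < p" "j < p"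
  shows "\<bar>A $$ (i, j)\<bar> \<le> (\<Sum>k<p. A $$ (k, k))"
proof (cases "i = j")
  case True
  have "A $$ (i, i) \<le> (\<Sum>k<p. A $$ (k, k))"
    using psd_diag_nonneg[OF A] ij by (intro member_le_sum) auto
  then show ?thesis using True psd_diag_nonneg[OF A ij(1)] by simp
next
  case False
  have "2 * \<bar>A $$ (i, j)\<bar> \<le> A $$ (i, i) + A $$ (j, j)"
    using psd_two_indices[OF A ij, of 1] psd_two_indices[OF A ij, of "-1"] by (simp add: abs_if)
  also have "\<dots> = (\<Sum>k\<in>{i, j}. A $$ (k, k))" using False by simp
  also have "\<dots> \<le> (\<Sum>k<p. A $$ (k, k))"
    using psd_diag_nonneg[OF A] ij by (intro sum_mono2) auto
  finally show ?thesis using psd_diag_nonneg[OF A] ij by simp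
qed

section \<open>Bounded densities with respect to the trace measure\<close>

lemma signed_borel_measure_add:
  assumes "signed_borel_measure a" "signed_borel_measure b"
  shows "signed_borel_measure (\<lambda>B. a B + b B)"
  using assms unfolding signed_borel_measure_def by (auto intro!: sums_add)

lemma signed_borel_measure_sum:
  assumes "\<And>i. i \<in> I \<Longrightarrow> signed_borel_measure (a i)"
  shows "signed_borel_measure (\<lambda>B. \<Sum>i\<in>I. a i B)"
  using assms unfolding signed_borel_measure_def by (auto intro!: sums_sum sum.neutral)

text \<open>Radon-Nikodym is applied to the positive measure \<open>\<nu> + M\<close>, which lies
  between 0 and twice \<open>M\<close>. Its density \<open>D\<close> is between 0 and 2 almost
  everywhere, and \<open>D - 1\<close> is the density of \<open>\<nu>\<close>.\<close>

lemma signed_density_exists: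
  assumes M: "finite_measure M" "sets M = sets borel"
    and \<nu>: "signed_borel_measure \<nu>" "\<And>B. B \<in> sets borel \<Longrightarrow> \<bar>\<nu> B\<bar> \<le> measure M B"
  shows "\<exists>w. w \<in> borel_measurable M \<and> (\<forall>x. \<bar>w x\<bar> \<le> 1) \<and>
    (\<forall>B\<in>sets borel. \<nu> B = (\<integral>x. indicator B x * w x \<partial>M))"
proof -
  interpret finite_measure M by (rule M)
  have signed_M: "signed_borel_measure (measure M)"
    unfolding signed_borel_measure_def using M(2) finite_measure_UNION by auto
  define \<rho> where "\<rho> = measure_of UNIV (sets borel) (\<lambda>B. ennreal (\<nu> B + measure M B))"
  have nn: "\<nu> B + measure M B \<ge> 0" if "B \<in> sets borel" for B using \<nu>(2)[OF that] by simp
  have em: "emeasure \<rho> B = ennreal (\<nu> B + measure M B)" if "B \<in> sets borel" for B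
    unfolding \<rho>_def
    by (rule signed_borel_measure_emeasure[OF signed_borel_measure_add[OF \<nu>(1) signed_M] nn that])
  have sets_\<rho>: "sets \<rho> = sets M"
    using sets.sigma_sets_eq[of "borel :: real measure"] M(2) by (simp add: \<rho>_def sets_measure_of)
  have space_\<rho>: "space \<rho> = UNIV" by (simp add: \<rho>_def space_measure_of_conv)
  have fin: "finite_measure \<rho>" by (rule finite_measureI) (simp add: space_\<rho> em)
  have ac: "absolutely_continuous M \<rho>"
  proof -
    have "emeasure \<rho> B = 0" if "B \<in> null_sets M" for B
    proof -
      have "measure M B = 0" "B \<in> sets borel" using that M(2) by (auto simp: null_sets_def measure_def)
      then show ?thesis using \<nu>(2)[of B] em[of B] by simp
    qed
    then show ?thesis unfolding absolutely_continuous_def null_sets_def using sets_\<rho> by auto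
  qed
  obtain D where D[measurable]: "D \<in> borel_measurable M"
    "AE x in M. RN_deriv M \<rho> x = ennreal (D x)" "\<And>x. 0 \<le> D x"
    using real_RN_deriv[OF fin ac sets_\<rho>] by metis
  have "density M (\<lambda>x. ennreal (D x)) = density M (RN_deriv M \<rho>)"
    by (rule density_cong) (use D(2) in auto)
  also have "\<dots> = \<rho>" by (rule density_RN_deriv[OF ac sets_\<rho>])
  finally have dens: "density M (\<lambda>x. ennreal (D x)) = \<rho>" .
  have D_int: "integrable M D"
  proof (rule integrableI_nonneg)
    have "(\<integral>\<^sup>+x. ennreal (D x) \<partial>M) = emeasure (density M (\<lambda>x. ennreal (D x))) (space M)"
      by (subst emeasure_density) (auto intro!: nn_integral_cong)
    also have "\<dots> = emeasure \<rho> UNIV"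
      unfolding dens using sets_eq_imp_space_eq[OF M(2)] by simp
    also have "\<dots> < \<infinity>" using em[of UNIV] by simp
    finally show "(\<integral>\<^sup>+x. ennreal (D x) \<partial>M) < \<infinity>" .
  qed (use D in auto)
  have D_set: "\<nu> B + measure M B = (\<integral>x. indicator B x * D x \<partial>M)" if B: "B \<in> sets borel" for B
  proof -
    have [measurable]: "B \<in> sets M" using B M(2) by simp
    have "ennreal (\<nu> B + measure M B) = (\<integral>\<^sup>+x. ennreal (D x) * indicator B x \<partial>M)"
      unfolding em[OF B, symmetric] dens[symmetric] by (rule emeasure_density) auto
    also have "\<dots> = (\<integral>\<^sup>+x. ennreal (indicator B x * D x) \<partial>M)"
      by (intro nn_integral_cong) (auto simp: indicator_def)
    also have "\<dots> = ennreal (\<integral>x. indicator B x * D x \<partial>M)"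
      using integrable_mult_indicator[OF \<open>B \<in> sets M\<close> D_int] D(3)
      by (intro nn_integral_eq_integral) (auto intro!: AE_I2)
    finally show ?thesis using nn[OF B] D(3) by (simp add: integral_nonneg)
  qed
  have ind_int: "integrable M (\<lambda>x. indicator B x * c :: real)" if "B \<in> sets M" for B c
    using integrable_mult_indicator[OF that, of "\<lambda>x. c"] by simp
  have indD_int: "integrable M (\<lambda>x. indicator B x * D x :: real)" if "B \<in> sets M" for B
    using integrable_mult_indicator[OF that D_int] by simp
  have le2: "AE x in M. 2 - D x \<ge> 0"
  proof (rule AE_nonneg_of_set_integral)
    show "integrable M (\<lambda>x. 2 - D x)" using D_int by simp
    fix B assume B: "B \<in> sets M"
    have "(\<integral>x. indicator B x * (2 - D x) \<partial>M) = (\<integral>x. indicator B x * 2 \<partial>M) - (\<integral>x. indicator B x * D x \<partial>M)"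
      using ind_int[OF B, of 2] indD_int[OF B]
      by (subst Bochner_Integration.integral_diff[symmetric]) (simp_all add: right_diff_distrib)
    also have "\<dots> = 2 * measure M B - (\<nu> B + measure M B)"
      using D_set B M(2) sets.sets_into_space[OF B] by (simp add: Int_absorb2)
    also have "\<dots> \<ge> 0" using \<nu>(2)[of B] B M(2) by (simp add: abs_le_iff)
    finally show "0 \<le> (\<integral>x. indicator B x * (2 - D x) \<partial>M)" .
  qed
  \<comment> \<open>By \<open>le2\<close> the cut at 1 changes \<open>D - 1\<close> only on a null
    set, and it makes the bound valid at every point.\<close>
  define w where "w = (\<lambda>x. min 1 (D x - 1))"
  have w[measurable]: "w \<in> borel_measurable M" unfolding w_def by measurable
  have "\<nu> B = (\<integral>x. indicator B x * w x \<partial>M)" if B: "B \<in> sets borel" for B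
  proof -
    have Bm[measurable]: "B \<in> sets M" using B M(2) by simp
    have "(\<integral>x. indicator B x * w x \<partial>M) = (\<integral>x. indicator B x * D x - indicator B x * 1 \<partial>M)"
    proof (rule integral_cong_AE)
      show "AE x in M. indicator B x * w x = indicator B x * D x - indicator B x * 1"
        using le2 by eventually_elim (auto simp: w_def algebra_simps min_def)
    qed measurable
    also have "\<dots> = (\<nu> B + measure M B) - measure M B"
      using ind_int[OF Bm, of 1] indD_int[OF Bm] D_set[OF B] sets.sets_into_space[OF Bm]
      by (subst Bochner_Integration.integral_diff) (simp_all add: Int_absorb2)
    finally show ?thesis by simp
  qed
  moreover have "\<bar>w x\<bar> \<le> 1" for x using D(3)[of x] by (auto simp: w_def min_def abs_if)
  ultimately show ?thesis using w by blast
qed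

text \<open>Testing only countably many vectors makes the exceptional null set of the density independent
  of the vector.\<close>

lemma quadratic_form_nonneg_of_rat:
  fixes M :: "nat \<Rightarrow> nat \<Rightarrow> real"
  assumes "\<And>l :: rat list. (\<Sum>i<p. \<Sum>j<p. of_rat (l ! i) * of_rat (l ! j) * M i j) \<ge> 0"
  shows "(\<Sum>i<p. \<Sum>j<p. v i * v j * M i j) \<ge> 0"
proof -
  have "\<exists>q :: rat. \<bar>of_rat q - v i\<bar> < 1 / real (Suc k)" for i k
  proof -
    have "v i - 1 / real (Suc k) < v i + 1 / real (Suc k)"
      using divide_pos_pos[of 1 "real (Suc k)"] by linarith
    from of_rat_dense[OF this] obtain q
      where "v i - 1 / real (Suc k) < of_rat q" "of_rat q < v i + 1 / real (Suc k)" by blast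
    then show ?thesis by (intro exI[of _ q]) (simp add: abs_less_iff)
  qed
  then obtain q :: "nat \<Rightarrow> nat \<Rightarrow> rat" where q: "\<And>i k. \<bar>of_rat (q i k) - v i\<bar> < 1 / real (Suc k)"
    by metis
  have lim: "(\<lambda>k. of_rat (q i k) :: real) \<longlonglongrightarrow> v i" for i
  proof (rule LIM_zero_cancel, rule Lim_null_comparison)
    show "eventually (\<lambda>k. norm (of_rat (q i k) - v i) \<le> 1 / real (Suc k)) sequentially"
      using q by (auto intro!: always_eventually less_imp_le)
    show "(\<lambda>k. 1 / real (Suc k)) \<longlonglongrightarrow> 0" by (rule LIMSEQ_Suc[OF lim_const_over_n])
  qed
  have "(\<lambda>k. \<Sum>i<p. \<Sum>j<p. of_rat (q i k) * of_rat (q j k) * M i j)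
        \<longlonglongrightarrow> (\<Sum>i<p. \<Sum>j<p. v i * v j * M i j)"
    by (intro tendsto_sum tendsto_mult lim tendsto_const)
  moreover have "(\<Sum>i<p. \<Sum>j<p. of_rat (q i k) * of_rat (q j k) * M i j) \<ge> 0" for k
    using assms[of "map (\<lambda>i. q i k) [0..<p]"] by simp
  ultimately show ?thesis by (intro LIMSEQ_le_const) auto
qed

text \<open>For a fixed vector, integrating the quadratic form of the densities over
  \<open>B\<close> gives the quadratic form of the matrix \<open>\<mu> B\<close>, so the integrand
  is nonnegative almost everywhere.\<close>

lemma matrix_density_exists:
  assumes \<mu>: "positive_matrix_measure p \<mu>"
  shows "\<exists>w. (\<forall>i<p. \<forall>j<p. w i j \<in> borel_measurable (trace_measure p \<mu>) \<and> (\<forall>x. \<bar>w i j x\<bar> \<le> 1) \<and>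
        (\<forall>B\<in>sets borel. \<mu> B $$ (i, j) = (\<integral>x. indicator B x * w i j x \<partial>trace_measure p \<mu>))) \<and>
      (AE x in trace_measure p \<mu>. \<forall>v. (\<Sum>i<p. \<Sum>j<p. v i * v j * w i j x) \<ge> 0)"
    and "finite_measure (trace_measure p \<mu>)" "sets (trace_measure p \<mu>) = sets borel"
    and "\<And>B. B \<in> sets borel \<Longrightarrow> emeasure (trace_measure p \<mu>) B = ennreal (\<Sum>i<p. \<mu> B $$ (i, i))"
proof -
  let ?M = "trace_measure p \<mu>"
  have psd: "psd p (\<mu> B)" if "B \<in> sets borel" for B
    using \<mu> that unfolding positive_matrix_measure_def by blast
  have signed: "signed_borel_measure (\<lambda>B. \<mu> B $$ (i, j))" if "i < p" "j < p" for i j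
    using \<mu> that unfolding positive_matrix_measure_def by blast
  have nn: "(\<Sum>i<p. \<mu> B $$ (i, i)) \<ge> 0" if "B \<in> sets borel" for B
    using psd_diag_nonneg[OF psd[OF that]] by (intro sum_nonneg) auto
  show em: "emeasure ?M B = ennreal (\<Sum>i<p. \<mu> B $$ (i, i))" if "B \<in> sets borel" for B
    unfolding trace_measure_def using nn that
    by (intro signed_borel_measure_emeasure signed_borel_measure_sum signed) auto
  show sets: "sets ?M = sets borel"
    using sets.sigma_sets_eq[of "borel :: real measure"] by (simp add: trace_measure_def sets_measure_of)
  have space: "space ?M = UNIV" by (simp add: trace_measure_def space_measure_of_conv)
  show fin: "finite_measure ?M" by (rule finite_measureI) (simp add: space em)
  interpret finite_measure ?M by (rule fin)
  have meas: "measure ?M B = (\<Sum>i<p. \<mu> B $$ (i, i))" if "B \<in> sets borel" for B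
    using em[OF that] nn[OF that] by (simp add: measure_def)
  let ?P = "\<lambda>i j w. w \<in> borel_measurable ?M \<and> (\<forall>x. \<bar>w x\<bar> \<le> 1) \<and>
        (\<forall>B\<in>sets borel. \<mu> B $$ (i, j) = (\<integral>x. indicator B x * w x \<partial>?M))"
  have ex: "\<exists>w. ?P i j w" if "i < p" "j < p" for i j
  proof (rule signed_density_exists[OF fin sets signed[OF that]])
    fix B :: "real set" assume "B \<in> sets borel"
    then show "\<bar>\<mu> B $$ (i, j)\<bar> \<le> measure ?M B"
      using psd_abs_le_trace[OF psd that] meas by simp
  qed
  define w where "w = (\<lambda>i j. SOME w. ?P i j w)"
  have w: "?P i j (w i j)" if "i < p" "j < p" for i j
    unfolding w_def by (rule someI_ex[OF ex[OF that]])
  have w_int: "integrable ?M (w i j)" if "i < p" "j < p" for i j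
    using w[OF that] by (intro integrable_const_bound[of _ 1]) auto
  \<comment> \<open>Rational vectors are encoded as lists because these form a countable type. An
    index beyond the length denotes some fixed rational, which is harmless since the inequality
    holds for every vector.\<close>
  have "AE x in ?M. (\<Sum>i<p. \<Sum>j<p. of_rat (l ! i) * of_rat (l ! j) * w i j x) \<ge> 0" for l :: "rat list"
  proof (rule AE_nonneg_of_set_integral)
    show "integrable ?M (\<lambda>x. \<Sum>i<p. \<Sum>j<p. of_rat (l ! i) * of_rat (l ! j) * w i j x)"
      using w_int by (intro Bochner_Integration.integrable_sum integrable_mult_right) auto
    fix B assume B: "B \<in> sets ?M"
    then have Bb: "B \<in> sets borel" using sets by simp
    have int: "integrable ?M (\<lambda>x. c * (indicator B x * w i j x))" if "i < p" "j < p" for i j c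
      using integrable_mult_indicator[OF B w_int[OF that]] by simp
    have "(\<integral>x. indicator B x * (\<Sum>i<p. \<Sum>j<p. of_rat (l ! i) * of_rat (l ! j) * w i j x) \<partial>?M) =
      (\<integral>x. (\<Sum>i<p. \<Sum>j<p. of_rat (l ! i) * of_rat (l ! j) * (indicator B x * w i j x)) \<partial>?M)"
      by (intro Bochner_Integration.integral_cong) (simp_all add: sum_distrib_left mult_ac)
    also have "\<dots> = (\<Sum>i<p. \<Sum>j<p. of_rat (l ! i) * of_rat (l ! j) * \<mu> B $$ (i, j))"
    proof (intro has_bochner_integral_integral_eq has_bochner_integral_sum)
      fix i j assume "i \<in> {..<p}" "j \<in> {..<p}"
      then show "has_bochner_integral ?M (\<lambda>x. of_rat (l ! i) * of_rat (l ! j) * (indicator B x * w i j x))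
        (of_rat (l ! i) * of_rat (l ! j) * \<mu> B $$ (i, j))"
        using int[of i j 1] w[of i j] Bb by (simp add: has_bochner_integral_iff)
    qed
    also have "\<dots> \<ge> 0" by (rule psd_quadratic[OF psd[OF Bb]])
    finally show "0 \<le> (\<integral>x. indicator B x * (\<Sum>i<p. \<Sum>j<p. of_rat (l ! i) * of_rat (l ! j) * w i j x) \<partial>?M)" .
  qed
  then have "AE x in ?M. \<forall>l :: rat list. (\<Sum>i<p. \<Sum>j<p. of_rat (l ! i) * of_rat (l ! j) * w i j x) \<ge> 0"
    by (simp add: AE_all_countable)
  then have "AE x in ?M. \<forall>v. (\<Sum>i<p. \<Sum>j<p. v i * v j * w i j x) \<ge> 0"
  proof (rule AE_mp, intro AE_I2 impI allI)
    fix x v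
    assume nonneg: "\<forall>l :: rat list. (\<Sum>i<p. \<Sum>j<p. of_rat (l ! i) * of_rat (l ! j) * w i j x) \<ge> 0"
    show "(\<Sum>i<p. \<Sum>j<p. v i * v j * w i j x) \<ge> 0"
      by (rule quadratic_form_nonneg_of_rat) (rule nonneg[THEN spec])
  qed
  then show "\<exists>w. (\<forall>i<p. \<forall>j<p. w i j \<in> borel_measurable ?M \<and> (\<forall>x. \<bar>w i j x\<bar> \<le> 1) \<and>
        (\<forall>B\<in>sets borel. \<mu> B $$ (i, j) = (\<integral>x. indicator B x * w i j x \<partial>?M))) \<and>
      (AE x in ?M. \<forall>v. (\<Sum>i<p. \<Sum>j<p. v i * v j * w i j x) \<ge> 0)"
    using w by (intro exI[of _ w]) simp
qed

subsection \<open>The quadratic form of a representing measure\<close>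

text \<open>For a representing measure and entries of degree at most \<open>n\<close>, this is the
  integral of \<open>F\<^sup>T d\<mu> F\<close>.\<close>

definition poly_form :: "nat \<Rightarrow> (real poly \<Rightarrow> real mat) \<Rightarrow> (nat \<Rightarrow> real poly) \<Rightarrow> real" where
  "poly_form p L F = (\<Sum>i<p. \<Sum>j<p. L (F i * F j) $$ (i, j))"

lemma representing_measure_entry:
  assumes \<mu>: "representing_measure n p L \<mu>" and ij: "i < p" "j < p" and f: "degree f \<le> 2 * n"
    and w: "w \<in> borel_measurable (trace_measure p \<mu>)" "\<And>x. \<bar>w x\<bar> \<le> 1"
      "\<And>B. B \<in> sets borel \<Longrightarrow> \<mu> B $$ (i, j) = (\<integral>x. indicator B x * w x \<partial>trace_measure p \<mu>)"
  shows "integrable (trace_measure p \<mu>) (\<lambda>x. poly f x * w x)"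
    and "L f $$ (i, j) = (\<integral>x. poly f x * w x \<partial>trace_measure p \<mu>)"
proof -
  have pm: "positive_matrix_measure p \<mu>" using \<mu> by (simp add: representing_measure_def)
  interpret finite_measure "trace_measure p \<mu>" by (rule matrix_density_exists(2)[OF pm])
  have int: "integrable (trace_measure p \<mu>) (poly f)" and L: "L f = matrix_integral p \<mu> f"
    using \<mu> f by (simp_all add: representing_measure_def matrix_integrable_def)
  show fw: "integrable (trace_measure p \<mu>) (\<lambda>x. poly f x * w x)"
  proof (rule Bochner_Integration.integrable_bound[OF int])
    show "(\<lambda>x. poly f x * w x) \<in> borel_measurable (trace_measure p \<mu>)"
      using int w(1) by (intro borel_measurable_times) auto
    show "AE x in trace_measure p \<mu>. norm (poly f x * w x) \<le> norm (poly f x)"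
      using w(2) by (intro AE_I2) (simp add: abs_mult mult_left_le)
  qed
  have "integrable (trace_measure p \<mu>) w"
    using w by (intro integrable_const_bound[of _ 1]) auto
  then have "signed_integral (\<lambda>B. \<mu> B $$ (i, j)) (poly f) = (\<integral>x. poly f x * w x \<partial>trace_measure p \<mu>)"
    using w(3) fw matrix_density_exists(3)[OF pm]
    by (intro signed_integral_density) (auto intro!: borel_measurable_continuous_onI continuous_intros)
  then show "L f $$ (i, j) = (\<integral>x. poly f x * w x \<partial>trace_measure p \<mu>)"
    using ij by (simp add: L matrix_integral_def)
qed

text \<open>The integrand is nonnegative almost everywhere, so its integral vanishes exactly when it
  does almost everywhere. The density \<open>w\<close> is chosen before \<open>F\<close>, which
  allows different tuples to be compared pointwise.\<close>

lemma poly_form_density: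
  assumes \<mu>: "representing_measure n p L \<mu>"
  shows "\<exists>w. \<forall>F. (\<forall>i<p. degree (F i) \<le> n) \<longrightarrow> poly_form p L F \<ge> 0 \<and> (poly_form p L F = 0 \<longleftrightarrow>
      (AE x in trace_measure p \<mu>. (\<Sum>i<p. \<Sum>j<p. poly (F i) x * poly (F j) x * w i j x) = 0))"
proof -
  have pm: "positive_matrix_measure p \<mu>" using \<mu> by (simp add: representing_measure_def)
  obtain w where w: "\<forall>i<p. \<forall>j<p. w i j \<in> borel_measurable (trace_measure p \<mu>) \<and> (\<forall>x. \<bar>w i j x\<bar> \<le> 1) \<and>
        (\<forall>B\<in>sets borel. \<mu> B $$ (i, j) = (\<integral>x. indicator B x * w i j x \<partial>trace_measure p \<mu>))"
    and pos: "AE x in trace_measure p \<mu>. \<forall>v. (\<Sum>i<p. \<Sum>j<p. v i * v j * w i j x) \<ge> 0"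
    using matrix_density_exists(1)[OF pm] by blast
  let ?h = "\<lambda>F x. \<Sum>i<p. \<Sum>j<p. poly (F i) x * poly (F j) x * w i j x"
  have bochner: "has_bochner_integral (trace_measure p \<mu>) (?h F) (poly_form p L F)"
    if F: "\<forall>i<p. degree (F i) \<le> n" for F
    unfolding poly_form_def
  proof (intro has_bochner_integral_sum)
    fix i j assume ij: "i \<in> {..<p}" "j \<in> {..<p}"
    then have "degree (F i) \<le> n" "degree (F j) \<le> n" using F by auto
    then have "degree (F i * F j) \<le> 2 * n"
      using degree_mult_le[of "F i" "F j"] by linarith
    then show "has_bochner_integral (trace_measure p \<mu>) (\<lambda>x. poly (F i) x * poly (F j) x * w i j x)
        (L (F i * F j) $$ (i, j))"
      using representing_measure_entry[OF \<mu>, of i j "F i * F j" "w i j"] w ij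
      by (simp add: has_bochner_integral_iff)
  qed
  have h: "AE x in trace_measure p \<mu>. 0 \<le> ?h F x" for F
  proof (rule AE_mp[OF pos], intro AE_I2 impI)
    fix x assume "\<forall>v. (\<Sum>i<p. \<Sum>j<p. v i * v j * w i j x) \<ge> 0"
    then show "0 \<le> ?h F x" by (rule spec)
  qed
  show ?thesis
  proof (intro exI allI impI conjI)
    fix F :: "nat \<Rightarrow> real poly" assume "\<forall>i<p. degree (F i) \<le> n"
    note b = bochner[OF this]
    have int: "integrable (trace_measure p \<mu>) (?h F)" and eq: "integral\<^sup>L (trace_measure p \<mu>) (?h F) = poly_form p L F"
      using b by (simp_all only: has_bochner_integral_iff)
    show "poly_form p L F \<ge> 0" using integral_nonneg_AE[OF h[of F]] by (simp only: eq)
    show "poly_form p L F = 0 \<longleftrightarrow> (AE x in trace_measure p \<mu>. ?h F x = 0)"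
      using integral_nonneg_eq_0_iff_AE[OF int h] by (simp only: eq)
  qed
qed

lemma poly_form_nonneg:
  assumes "representing_measure n p L \<mu>" "\<forall>i<p. degree (F i) \<le> n"
  shows "poly_form p L F \<ge> 0"
  using poly_form_density[OF assms(1)] assms(2) by (elim exE) (drule spec[of _ F], simp)

lemma poly_form_mult:
  fixes g :: "real poly"
  shows
  "(\<Sum>i<p. \<Sum>j<p. poly (g * F i) x * poly (g * F j) x * w i j x) =
   (poly g x)\<^sup>2 * (\<Sum>i<p. \<Sum>j<p. poly (F i) x * poly (F j) x * w i j x)"
  unfolding sum_distrib_left by (intro sum.cong refl) (simp only: poly_mult power2_eq_square mult_ac)

text \<open>Multiplying a tuple by \<open>g\<close> multiplies the integrand by the square of
  \<open>g\<close>. An actual measure is essential: for \<open>n = p = 1\<close>, the moments 0, 0,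
  1 give a positive semidefinite moment matrix, yet the null vector 1 goes to \<open>x\<close>,
  which is not null.\<close>

lemma poly_form_null_mult:
  assumes \<mu>: "representing_measure n p L \<mu>"
    and F: "\<forall>i<p. degree (F i) \<le> n" "\<forall>i<p. degree (g * F i) \<le> n"
    and null: "poly_form p L F = 0"
  shows "poly_form p L (\<lambda>i. g * F i) = 0"
proof -
  obtain w where w: "\<forall>F. (\<forall>i<p. degree (F i) \<le> n) \<longrightarrow> poly_form p L F \<ge> 0 \<and> (poly_form p L F = 0 \<longleftrightarrow>
      (AE x in trace_measure p \<mu>. (\<Sum>i<p. \<Sum>j<p. poly (F i) x * poly (F j) x * w i j x) = 0))"
    using poly_form_density[OF \<mu>] ..
  have "AE x in trace_measure p \<mu>. (\<Sum>i<p. \<Sum>j<p. poly (F i) x * poly (F j) x * w i j x) = 0"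
    using null w[THEN spec, THEN mp, OF F(1)] by simp
  then have "AE x in trace_measure p \<mu>. (\<Sum>i<p. \<Sum>j<p. poly (g * F i) x * poly (g * F j) x * w i j x) = 0"
    unfolding poly_form_mult by eventually_elim simp
  then show ?thesis using w[THEN spec, THEN mp, OF F(2)] by simp
qed

text \<open>The squared factor can be divided out of the integrand except at \<open>t\<close>, and
  \<open>{t}\<close> is null for the trace measure.\<close>

lemma poly_form_null_cancel:
  assumes \<mu>: "representing_measure n p L \<mu>" and t: "\<mu> {t} = 0\<^sub>m p p"
    and F: "\<forall>i<p. degree (F i) \<le> n" "\<forall>i<p. degree ([:- t, 1:] * F i) \<le> n"
    and null: "poly_form p L (\<lambda>i. [:- t, 1:] * F i) = 0"
  shows "poly_form p L F = 0"
proof -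
  have pm: "positive_matrix_measure p \<mu>" using \<mu> by (simp add: representing_measure_def)
  obtain w where w: "\<forall>F. (\<forall>i<p. degree (F i) \<le> n) \<longrightarrow> poly_form p L F \<ge> 0 \<and> (poly_form p L F = 0 \<longleftrightarrow>
      (AE x in trace_measure p \<mu>. (\<Sum>i<p. \<Sum>j<p. poly (F i) x * poly (F j) x * w i j x) = 0))"
    using poly_form_density[OF \<mu>] ..
  have "{t} \<in> null_sets (trace_measure p \<mu>)"
    using matrix_density_exists(3,4)[OF pm] t by (intro null_setsI) auto
  then have "AE x in trace_measure p \<mu>. x \<noteq> t"
    by (intro AE_I'[of "{t}"]) auto
  moreover have "AE x in trace_measure p \<mu>.
      (\<Sum>i<p. \<Sum>j<p. poly ([:- t, 1:] * F i) x * poly ([:- t, 1:] * F j) x * w i j x) = 0"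
    using null w[THEN spec, THEN mp, OF F(2)] by simp
  ultimately have "AE x in trace_measure p \<mu>. (\<Sum>i<p. \<Sum>j<p. poly (F i) x * poly (F j) x * w i j x) = 0"
    unfolding poly_form_mult by eventually_elim simp
  then show ?thesis using w[THEN spec, THEN mp, OF F(1)] by simp
qed

subsection \<open>Rank and finitely atomic matrix measures\<close>

text \<open>The matrix is \<open>Q * Q\<^sup>T\<close> with \<open>Q\<close> injective. Over the
  reals \<open>Q\<^sup>T * Q\<close> is then invertible, so \<open>Q * Q\<^sup>T\<close> and
  \<open>Q\<close> have the same column space.\<close>

lemma rank_sum_outer:
  fixes b :: "nat \<Rightarrow> nat \<Rightarrow> real"
  assumes indep: "\<And>c. (\<And>i. i < N \<Longrightarrow> (\<Sum>k<s. c k * b k i) = 0) \<Longrightarrow> (\<forall>k<s. c k = 0)"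
  shows "mat_rank (mat N N (\<lambda>(i, j). \<Sum>k<s. b k i * b k j)) = s"
proof -
  interpret vec_space "TYPE(real)" N .
  define Q where "Q = mat N s (\<lambda>(i, k). b k i)"
  define P where "P = mat N N (\<lambda>(i, j). \<Sum>k<s. b k i * b k j)"
  have Q: "Q \<in> carrier_mat N s" "Q\<^sup>T \<in> carrier_mat s N" and P: "P \<in> carrier_mat N N"
    by (simp_all add: Q_def P_def)
  have PQ: "P = Q * Q\<^sup>T"
    by (rule eq_matI) (auto simp: P_def Q_def scalar_prod_def atLeast0LessThan)
  have inj: "v = 0\<^sub>v s" if v: "v \<in> carrier_vec s" "Q *\<^sub>v v = 0\<^sub>v N" for v
  proof -
    have "(\<Sum>k<s. v $ k * b k i) = 0" if "i < N" for i
    proof -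
      have "(Q *\<^sub>v v) $ i = (\<Sum>k<s. v $ k * b k i)"
        using that v(1) by (simp add: Q_def scalar_prod_def atLeast0LessThan mult.commute)
      then show ?thesis using v(2) that by simp
    qed
    then have "\<forall>k<s. v $ k = 0" by (rule indep)
    then show ?thesis using v(1) by (intro eq_vecI) auto
  qed
  have distinct: "distinct (cols Q)"
  proof (rule ccontr)
    assume "\<not> distinct (cols Q)"
    then obtain k l where kl: "k < s" "l < s" "k \<noteq> l" "col Q k = col Q l"
      using Q(1) by (auto simp: distinct_conv_nth)
    have "b k i = b l i" if "i < N" for i
      using arg_cong[OF kl(4), of "\<lambda>v. v $ i"] that kl by (simp add: Q_def)
    then have "(\<Sum>m<s. (of_bool (m = k) - of_bool (m = l)) * b m i) = 0" if "i < N" for i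
      using that kl by (simp add: left_diff_distrib sum_subtractf of_bool_def
          if_distrib[of "\<lambda>x. x * _"] cong: if_cong)
    from indep[OF this] have "of_bool (k = k) - of_bool (k = l) = (0 :: real)" using kl(1) by blast
    then show False using kl(3) by simp
  qed
  have "lin_indpt (set (cols Q))"
    using lin_depE[OF Q(1) _ distinct] inj by metis
  then have rank_Q: "rank Q = s" by (rule lin_indpt_full_rank[OF Q(1) distinct])
  have "det (Q\<^sup>T * Q) \<noteq> 0"
  proof
    assume "det (Q\<^sup>T * Q) = 0"
    then obtain v where v: "v \<in> carrier_vec s" "v \<noteq> 0\<^sub>v s" "(Q\<^sup>T * Q) *\<^sub>v v = 0\<^sub>v s"
      using det_0_iff_vec_prod_zero_field[of "Q\<^sup>T * Q" s] Q by auto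
    have Qv: "Q *\<^sub>v v \<in> carrier_vec N" using Q(1) v(1) by simp
    have "scalar_prod (Q *\<^sub>v v) (Q *\<^sub>v v) = scalar_prod v (Q\<^sup>T *\<^sub>v (Q *\<^sub>v v))"
      using transpose_vec_mult_scalar[OF Q(2) Qv v(1)] Q(1) v(1) Qv
      by (simp add: comm_scalar_prod[of v s])
    also have "\<dots> = 0" using v Q assoc_mult_mat_vec[OF Q(2) Q(1) v(1)] by simp
    finally have "(\<Sum>i<N. ((Q *\<^sub>v v) $ i)\<^sup>2) = 0"
      using Q(1) by (simp add: scalar_prod_def atLeast0LessThan power2_eq_square)
    then have "\<forall>i<N. (Q *\<^sub>v v) $ i = 0" by (subst (asm) sum_nonneg_eq_0_iff) auto
    then have "Q *\<^sub>v v = 0\<^sub>v N" using carrier_vecD[OF Qv] by (intro eq_vecI) simp_all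
    then show False using inj v by blast
  qed
  then obtain G where G: "G \<in> carrier_mat s s" "(Q\<^sup>T * Q) * G = 1\<^sub>m s"
    using det_non_zero_imp_unit[of "Q\<^sup>T * Q" s, unfolded Units_def, of "()"] Q
    by (auto simp: ring_mat_def)
  have "col_space P = col_space Q"
  proof
    show "col_space P \<subseteq> col_space Q"
    proof
      fix y assume "y \<in> col_space P"
      then obtain x where x: "x \<in> carrier_vec N" "y = P *\<^sub>v x" using P unfolding col_space_eq[OF P] by auto
      then have "y = Q *\<^sub>v (Q\<^sup>T *\<^sub>v x)" using assoc_mult_mat_vec[OF Q(1,2) x(1)] by (simp add: PQ)
      then show "y \<in> col_space Q" using Q x unfolding col_space_eq[OF Q(1)] by auto
    qed
    show "col_space Q \<subseteq> col_space P"
    proof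
      fix y assume "y \<in> col_space Q"
      then obtain v where v: "v \<in> carrier_vec s" "y = Q *\<^sub>v v" using Q unfolding col_space_eq[OF Q(1)] by auto
      \<comment> \<open>As \<open>G\<close> inverts \<open>Q\<^sup>T * Q\<close>, this vector is a
        preimage of \<open>Q *\<^sub>v v\<close> under \<open>P\<close>.\<close>
      define x where "x = Q *\<^sub>v (G *\<^sub>v v)"
      have x: "x \<in> carrier_vec N" using Q G v by (simp add: x_def)
      have Gv: "G *\<^sub>v v \<in> carrier_vec s" using G v by simp
      have "P *\<^sub>v x = Q *\<^sub>v (Q\<^sup>T *\<^sub>v x)" using assoc_mult_mat_vec[OF Q(1,2) x] by (simp add: PQ)
      also have "Q\<^sup>T *\<^sub>v x = (Q\<^sup>T * Q) *\<^sub>v (G *\<^sub>v v)"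
        unfolding x_def using assoc_mult_mat_vec[OF Q(2,1) Gv] by simp
      also have "\<dots> = ((Q\<^sup>T * Q) * G) *\<^sub>v v"
        using assoc_mult_mat_vec[OF _ G(1) v(1), of "Q\<^sup>T * Q" s] Q by simp
      also have "\<dots> = v" using G v by simp
      finally have "P *\<^sub>v x = y" using v by simp
      then show "y \<in> col_space P" using x P unfolding col_space_eq[OF P] by auto
    qed
  qed
  then have "rank P = rank Q" unfolding rank_def col_space_def by simp
  then show ?thesis using rank_Q by (simp add: P_def)
qed

lemma rank_eq_0_imp_zero:
  assumes A: "A \<in> carrier_mat N m" and "vec_space.rank N (A :: real mat) = 0"
  shows "A = 0\<^sub>m N m"
proof (rule ccontr)
  interpret vec_space "TYPE(real)" N .
  assume "A \<noteq> 0\<^sub>m N m"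
  then obtain i j where ij: "i < N" "j < m" "A $$ (i, j) \<noteq> 0" using A by (auto simp: mat_eq_iff)
  have cA: "col A j \<in> set (cols A)" using A ij by (simp add: cols_def)
  have carrier: "col A j \<in> carrier_vec N" using carrier_matD(1)[OF A] by (intro carrier_vecI) simp
  have "lin_indpt {col A j}"
  proof
    assume dep: "lin_dep {col A j}"
    let ?C = "mat_of_cols N [col A j]"
    have C: "?C \<in> carrier_mat N 1" "cols ?C = [col A j]" using carrier by (auto simp: cols_mat_of_cols)
    obtain v where v: "v \<in> carrier_vec 1" "v \<noteq> 0\<^sub>v 1" "?C *\<^sub>v v = 0\<^sub>v N"
      using lin_depE[OF C(1)] dep C(2) by auto
    have "v $ 0 \<noteq> 0" using v by (auto simp: vec_eq_iff)
    moreover have "(?C *\<^sub>v v) $ i = A $$ (i, j) * v $ 0"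
      using ij v(1) A by (simp add: scalar_prod_def mat_of_cols_def)
    ultimately show False using v(3) ij by simp
  qed
  then have "rank A \<ge> card {col A j}" using cA by (intro rank_ge_card_indpt[OF A]) auto
  then show False using assms(2) by simp
qed

section \<open>Finitely atomic matrix measures\<close>

definition atomic_matrix_measure :: "nat \<Rightarrow> nat \<Rightarrow> (nat \<Rightarrow> real) \<Rightarrow> (nat \<Rightarrow> real mat) \<Rightarrow> real set \<Rightarrow> real mat" where
  "atomic_matrix_measure p l x A B =
     mat p p (\<lambda>(a, b). \<Sum>j<l. measure (return borel (x j)) B * A j $$ (a, b))"

context
  fixes p l :: nat and x :: "nat \<Rightarrow> real" and A :: "nat \<Rightarrow> real mat"
  assumes x: "inj_on x {..<l}" and A: "\<And>j. j < l \<Longrightarrow> psd p (A j)"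
begin

text \<open>Counting measure on the nodes: a single base measure over which all entries have
  densities, so that the density formula for signed integrals applies.\<close>

definition atoms :: "real measure" where
  "atoms = distr (count_space {..<l}) borel x"

definition at_atoms :: "(nat \<Rightarrow> real) \<Rightarrow> real \<Rightarrow> real" where
  "at_atoms c y = (\<Sum>j<l. c j * indicator {x j} y)"

lemma at_atoms: "k < l \<Longrightarrow> at_atoms c (x k) = c k"
proof -
  assume k: "k < l"
  have "at_atoms c (x k) = (\<Sum>j<l. if j = k then c j else 0)"
    unfolding at_atoms_def using k x by (intro sum.cong) (auto simp: inj_on_def indicator_def)
  then show ?thesis using k by simp
qed

lemma at_atoms_measurable[measurable]: "at_atoms c \<in> borel_measurable borel"
  unfolding at_atoms_def by measurable

lemma sets_atoms: "sets atoms = sets borel"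
  by (simp add: atoms_def)

lemma integrable_atoms: "g \<in> borel_measurable borel \<Longrightarrow> integrable atoms (g :: real \<Rightarrow> real)"
  unfolding atoms_def by (subst integrable_distr_eq) (auto intro: integrable_count_space)

lemma integral_atoms:
  "g \<in> borel_measurable borel \<Longrightarrow> (\<integral>y. g y \<partial>atoms) = (\<Sum>j<l. g (x j) :: real)"
  unfolding atoms_def by (subst integral_distr) (auto simp: lebesgue_integral_count_space_finite)

lemma positive_atomic: "positive_matrix_measure p (atomic_matrix_measure p l x A)"
  unfolding positive_matrix_measure_def
proof (intro conjI allI impI ballI)
  fix i j assume ij: "i < p" "j < p"
  have "signed_borel_measure (\<lambda>B. measure (return borel y) B * c)" for y c :: real
  proof -
    interpret prob_space "return borel y" by (rule prob_space_return) simp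
    show ?thesis
      unfolding signed_borel_measure_def using finite_measure_UNION
      by (auto intro!: sums_mult2)
  qed
  then show "signed_borel_measure (\<lambda>B. atomic_matrix_measure p l x A B $$ (i, j))"
    using ij by (simp add: atomic_matrix_measure_def signed_borel_measure_sum)
next
  fix B :: "real set" assume "B \<in> sets borel"
  have "(\<Sum>a<p. \<Sum>b<p. v a * v b * (\<Sum>j<l. measure (return borel (x j)) B * A j $$ (a, b))) \<ge> 0" for v
  proof -
    have "(\<Sum>a<p. \<Sum>b<p. v a * v b * (\<Sum>j<l. measure (return borel (x j)) B * A j $$ (a, b)))
      = (\<Sum>a<p. \<Sum>b<p. \<Sum>j<l. measure (return borel (x j)) B * (v a * v b * A j $$ (a, b)))"
      by (simp only: sum_distrib_left mult_ac)
    also have "\<dots> = (\<Sum>a<p. \<Sum>j<l. \<Sum>b<p. measure (return borel (x j)) B * (v a * v b * A j $$ (a, b)))"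
      by (intro sum.cong refl sum.swap)
    also have "\<dots> = (\<Sum>j<l. \<Sum>a<p. \<Sum>b<p. measure (return borel (x j)) B * (v a * v b * A j $$ (a, b)))"
      by (rule sum.swap)
    also have "\<dots> = (\<Sum>j<l. measure (return borel (x j)) B * (\<Sum>a<p. \<Sum>b<p. v a * v b * A j $$ (a, b)))"
      by (simp only: sum_distrib_left)
    also have "\<dots> \<ge> 0"
    proof (rule sum_nonneg)
      fix j assume "j \<in> {..<l}"
      then show "0 \<le> measure (return borel (x j)) B * (\<Sum>a<p. \<Sum>b<p. v a * v b * A j $$ (a, b))"
        using psd_quadratic[OF A, of j v] by simp
    qed
    finally show ?thesis .
  qed
  moreover have "A k $$ (i, j) = A k $$ (j, i)" if "k < l" "i < p" "j < p" for k i j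
    using A[OF that(1)] that unfolding psd_iff by blast
  ultimately show "psd p (atomic_matrix_measure p l x A B)"
    unfolding psd_iff atomic_matrix_measure_def by simp
qed

lemma atomic_entry:
  assumes "B \<in> sets borel" "i < p" "j < p"
  shows "atomic_matrix_measure p l x A B $$ (i, j) = (\<integral>y. indicator B y * at_atoms (\<lambda>k. A k $$ (i, j)) y \<partial>atoms)"
  using assms by (subst integral_atoms) (auto simp: atomic_matrix_measure_def at_atoms measure_return)

lemma matrix_integral_atomic:
  "matrix_integral p (atomic_matrix_measure p l x A) f = mat p p (\<lambda>(i, j). \<Sum>k<l. poly f (x k) * A k $$ (i, j))"
proof -
  have f[measurable]: "poly f \<in> borel_measurable borel"
    by (intro borel_measurable_continuous_onI continuous_intros)
  have "signed_integral (\<lambda>B. atomic_matrix_measure p l x A B $$ (i, j)) (poly f) = (\<Sum>k<l. poly f (x k) * A k $$ (i, j))"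
    if "i < p" "j < p" for i j
  proof -
    have "signed_integral (\<lambda>B. atomic_matrix_measure p l x A B $$ (i, j)) (poly f)
        = (\<integral>y. poly f y * at_atoms (\<lambda>k. A k $$ (i, j)) y \<partial>atoms)"
      using atomic_entry that by (intro signed_integral_density sets_atoms integrable_atoms f) auto
    also have "\<dots> = (\<Sum>k<l. poly f (x k) * A k $$ (i, j))"
      by (subst integral_atoms) (auto simp: at_atoms)
    finally show ?thesis .
  qed
  then show ?thesis unfolding matrix_integral_def by (intro eq_matI) auto
qed

text \<open>The trace measure has a density over \<open>atoms\<close>, and every Borel function is
  integrable against finitely many nodes.\<close>

lemma matrix_integrable_atomic: "matrix_integrable p (atomic_matrix_measure p l x A) f"
proof -
  let ?w = "at_atoms (\<lambda>k. \<Sum>i<p. A k $$ (i, i))"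
  have f[measurable]: "poly f \<in> borel_measurable borel"
    by (intro borel_measurable_continuous_onI continuous_intros)
  have nn: "(\<Sum>i<p. A k $$ (i, i)) \<ge> 0" if "k < l" for k
    using psd_diag_nonneg[OF A[OF that]] by (intro sum_nonneg) auto
  have w: "?w y \<ge> 0" for y unfolding at_atoms_def using nn by (intro sum_nonneg) auto
  have "trace_measure p (atomic_matrix_measure p l x A) = density atoms (\<lambda>y. ennreal (?w y))"
    unfolding trace_measure_def
  proof (rule measure_of_borel_eqI)
    show "sets (density atoms (\<lambda>y. ennreal (?w y))) = sets borel" by (simp add: sets_atoms)
    fix B :: "real set" assume B: "B \<in> sets borel"
    have "emeasure (density atoms (\<lambda>y. ennreal (?w y))) B = (\<integral>\<^sup>+y. ennreal (?w y * indicator B y) \<partial>atoms)"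
      using B by (subst emeasure_density)
        (auto simp: sets_atoms measurable_cong_sets[OF sets_atoms refl] indicator_def intro!: nn_integral_cong)
    also have "\<dots> = ennreal (\<integral>y. ?w y * indicator B y \<partial>atoms)"
      using B w by (intro nn_integral_eq_integral integrable_atoms) auto
    also have "(\<integral>y. ?w y * indicator B y \<partial>atoms) = (\<Sum>k<l. (\<Sum>i<p. A k $$ (i, i)) * indicator B (x k))"
      using B by (subst integral_atoms) (auto simp: at_atoms)
    also have "\<dots> = (\<Sum>i<p. atomic_matrix_measure p l x A B $$ (i, i))"
      using B by (simp add: atomic_matrix_measure_def measure_return sum_distrib_right mult.commute)
        (rule sum.swap)
    finally show "ennreal (\<Sum>i<p. atomic_matrix_measure p l x A B $$ (i, i)) = emeasure (density atoms (\<lambda>y. ennreal (?w y))) B"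
      by simp
  qed
  moreover have "integrable (density atoms (\<lambda>y. ennreal (?w y))) (poly f)"
  proof (subst integrable_density)
    show "poly f \<in> borel_measurable atoms" "?w \<in> borel_measurable atoms"
      by (simp_all add: measurable_cong_sets[OF sets_atoms refl])
    show "integrable atoms (\<lambda>y. ?w y *\<^sub>R poly f y)" by (rule integrable_atoms) simp
  qed (use w in auto)
  ultimately show ?thesis unfolding matrix_integrable_def by simp
qed

end

subsection \<open>The moment form\<close>

lemma rank_sum_outer_set:
  fixes b :: "'k \<Rightarrow> nat \<Rightarrow> real"
  assumes K: "finite K"
    and indep: "\<And>c. (\<And>i. i < N \<Longrightarrow> (\<Sum>k\<in>K. c k * b k i) = 0) \<Longrightarrow> (\<forall>k\<in>K. c k = 0)"
  shows "mat_rank (mat N N (\<lambda>(i, j). \<Sum>k\<in>K. b k i * b k j)) = card K"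
proof -
  obtain e where e: "bij_betw e {..<card K} K"
    using ex_bij_betw_nat_finite[OF K] by (auto simp: atLeast0LessThan)
  have "mat_rank (mat N N (\<lambda>(i, j). \<Sum>k<card K. b (e k) i * b (e k) j)) = card K"
  proof (rule rank_sum_outer)
    fix c assume c: "\<And>i. i < N \<Longrightarrow> (\<Sum>k<card K. c k * b (e k) i) = 0"
    let ?c = "\<lambda>k. c (the_inv_into {..<card K} e k)"
    have ce: "?c (e k) = c k" if "k < card K" for k
      using e that by (simp add: bij_betw_def the_inv_into_f_f)
    have "(\<Sum>k\<in>K. ?c k * b k i) = (\<Sum>k<card K. c k * b (e k) i)" for i
      unfolding sum.reindex_bij_betw[OF e, symmetric] using ce by (intro sum.cong) auto
    then have "\<forall>k\<in>K. ?c k = 0" using c by (intro indep) simp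
    then show "\<forall>k<card K. c k = 0"
      using ce bij_betwE[OF e] by (metis lessThan_iff)
  qed
  also have "(\<lambda>(i, j). \<Sum>k<card K. b (e k) i * b (e k) j) = (\<lambda>(i, j). \<Sum>k\<in>K. b k i * b k j)"
    by (simp add: sum.reindex_bij_betw[OF e, of "\<lambda>k. b k _ * b k _"])
  finally show ?thesis .
qed

lemma sum_blocks:
  fixes h :: "nat \<Rightarrow> 'a::comm_monoid_add"
  shows "(\<Sum>m<q * p. h m) = (\<Sum>k<q. \<Sum>i<p. h (k * p + i))"
proof -
  have inner: "sum h {k * p..<k * p + p} = (\<Sum>i<p. h (k * p + i))" for k
    using sum.shift_bounds_nat_ivl[of h 0 "k * p" p] by (simp add: add.commute atLeast0LessThan)
  have "(\<Sum>m<q * p. h m) = (\<Sum>k<q. sum h {k * p..<k * p + p})" by (rule sum.nat_group[symmetric])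
  also have "\<dots> = (\<Sum>k<q. \<Sum>i<p. h (k * p + i))"
    by (simp only: inner)
  finally show ?thesis .
qed

text \<open>Multiplication by \<open>x - t\<close> in coordinates: the coefficient block of each
  power moves to the next power.\<close>

definition block_shift :: "nat \<Rightarrow> (nat \<Rightarrow> real) \<Rightarrow> nat \<Rightarrow> real" where
  "block_shift p f i = (if i < p then 0 else f (i - p))"

lemma sum_block_shift:
  "(\<Sum>i<m + p. block_shift p f i * h i) = (\<Sum>i<m. f i * h (i + p))"
proof -
  have "(\<Sum>i<m + p. block_shift p f i * h i) = (\<Sum>i\<in>{p..<m + p}. block_shift p f i * h i)"
    by (intro sum.mono_neutral_right) (auto simp: block_shift_def)
  also have "\<dots> = (\<Sum>i\<in>{0..<m}. block_shift p f (i + p) * h (i + p))"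
    using sum.shift_bounds_nat_ivl[of "\<lambda>i. block_shift p f i * h i" 0 p m] by simp
  finally show ?thesis by (simp add: block_shift_def atLeast0LessThan)
qed

lemma block_shift_unit: "block_shift p (\<lambda>j. of_bool (j = m)) = (\<lambda>j. of_bool (j = m + p))"
  by (auto simp: block_shift_def fun_eq_iff)

section \<open>The moment form as a truncated shift\<close>

locale moment_problem =
  fixes n p :: nat and L :: "real poly \<Rightarrow> real mat" and t :: real and \<mu>0 :: "real set \<Rightarrow> real mat"
  assumes p_pos: "p \<ge> 1"
    and linear: "linear_operator (2 * n) p L"
    and representing: "representing_measure n p L \<mu>0"
begin

definition T :: "nat \<Rightarrow> real mat" where "T i = L ([:- t, 1:] ^ i)"

definition B :: "(nat \<Rightarrow> real) \<Rightarrow> (nat \<Rightarrow> real) \<Rightarrow> real" where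
  "B f g = (\<Sum>m<(n + 1) * p. \<Sum>m'<(n + 1) * p.
     f m * T (m div p + m' div p) $$ (m mod p, m' mod p) * g m')"

text \<open>\<open>f\<close> lists the coefficients in the basis \<open>(x - t)\<^sup>k e\<^sub>i\<close>, ordered by \<open>k p + i\<close>.\<close>

definition tuple :: "(nat \<Rightarrow> real) \<Rightarrow> nat \<Rightarrow> real poly" where
  "tuple f i = (\<Sum>k\<le>n. Polynomial.smult (f (k * p + i)) ([:- t, 1:] ^ k))"

lemma degree_power_le: "k \<le> d \<Longrightarrow> degree ([:- t, 1:] ^ k) \<le> d"
  using degree_linear_power[of "- t" k] by simp

text \<open>Linearity of \<open>L\<close> is granted only up to degree \<open>2 * n\<close>, so the
  degree bound travels through the induction together with the value.\<close>

lemma L_sum: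
  assumes "finite K" "\<And>k. k \<in> K \<Longrightarrow> degree (g k) \<le> 2 * n" "i < p" "j < p"
  shows "degree (\<Sum>k\<in>K. Polynomial.smult (c k) (g k)) \<le> 2 * n \<and>
    L (\<Sum>k\<in>K. Polynomial.smult (c k) (g k)) $$ (i, j) = (\<Sum>k\<in>K. c k * L (g k) $$ (i, j))"
  using assms(1,2)
proof (induction K rule: finite_induct)
  case empty
  have "degree (0 :: real poly) \<le> 2 * n" by simp
  then have "L (Polynomial.smult 0 0) = 0 \<cdot>\<^sub>m L 0" and c: "L 0 \<in> carrier_mat p p"
    using linear unfolding linear_operator_def sym_mats_def by blast+
  then have z: "L 0 = 0 \<cdot>\<^sub>m L 0" "L 0 \<in> carrier_mat p p" by (simp_all only: smult_0_left)
  then have "L 0 $$ (i, j) = (0 \<cdot>\<^sub>m L 0) $$ (i, j)" by metis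
  also have "\<dots> = 0" using z(2) assms(3,4) by simp
  finally show ?case by simp
next
  case (insert a K)
  let ?s = "Polynomial.smult (c a) (g a)" and ?r = "\<Sum>k\<in>K. Polynomial.smult (c k) (g k)"
  have d: "degree (g a) \<le> 2 * n" "degree ?s \<le> 2 * n" "degree ?r \<le> 2 * n"
    using insert degree_smult_le[of "c a" "g a"] by (auto intro: order_trans)
  have "L (?s + ?r) = L ?s + L ?r" "L ?s = c a \<cdot>\<^sub>m L (g a)"
    using linear d unfolding linear_operator_def by blast+
  moreover have "L (g a) \<in> carrier_mat p p" "L ?r \<in> carrier_mat p p"
    using linear d unfolding linear_operator_def sym_mats_def by blast+
  ultimately have "L (?s + ?r) $$ (i, j) = c a * L (g a) $$ (i, j) + L ?r $$ (i, j)"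
    using assms(3,4) by simp
  then show ?case using insert d degree_add_le[of ?s "2 * n" ?r] by simp
qed

lemma T_symmetric:
  assumes "q \<le> 2 * n" "i < p" "j < p"
  shows "T q $$ (i, j) = T q $$ (j, i)"
proof -
  have "degree ([:- t, 1:] ^ q) \<le> 2 * n" by (rule degree_power_le[OF assms(1)])
  then have "T q \<in> sym_mats p" using linear unfolding linear_operator_def T_def by blast
  then have "T q \<in> carrier_mat p p" "(T q)\<^sup>T = T q" unfolding sym_mats_def by auto
  then show ?thesis using assms(2,3) by (metis carrier_matD index_transpose_mat(1))
qed

lemma degree_tuple: "degree (tuple f i) \<le> n"
  unfolding tuple_def
  by (intro degree_sum_le order_trans[OF degree_smult_le] degree_power_le) auto

text \<open>Through this identity, positivity and nullness obtained from integrals become statements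
  about \<open>B\<close>.\<close>

lemma poly_form_tuple: "poly_form p L (tuple f) = B f f"
proof -
  have entry: "L (tuple f i * tuple f j) $$ (i, j) =
      (\<Sum>k<n+1. \<Sum>k'<n+1. f (k * p + i) * T (k + k') $$ (i, j) * f (k' * p + j))"
    if ij: "i < p" "j < p" for i j
  proof -
    have deg: "degree ([:- t, 1:] ^ (fst q + snd q)) \<le> 2 * n" if "q \<in> {..n} \<times> {..n}" for q
      using that by (intro degree_power_le) auto
    have "tuple f i * tuple f j = (\<Sum>k\<le>n. \<Sum>k'\<le>n. Polynomial.smult (f (k * p + i) * f (k' * p + j)) ([:- t, 1:] ^ (k + k')))"
      unfolding tuple_def sum_product by (intro sum.cong refl) (simp add: power_add mult.commute)
    also have "\<dots> = (\<Sum>q\<in>{..n} \<times> {..n}. Polynomial.smult (f (fst q * p + i) * f (snd q * p + j)) ([:- t, 1:] ^ (fst q + snd q)))"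
      by (simp add: sum.cartesian_product split_beta)
    finally have "L (tuple f i * tuple f j) $$ (i, j)
      = (\<Sum>q\<in>{..n} \<times> {..n}. f (fst q * p + i) * f (snd q * p + j) * L ([:- t, 1:] ^ (fst q + snd q)) $$ (i, j))"
      using L_sum[OF _ deg ij, of "{..n} \<times> {..n}", THEN conjunct2] by simp
    also have "\<dots> = (\<Sum>k\<le>n. \<Sum>k'\<le>n. f (k * p + i) * T (k + k') $$ (i, j) * f (k' * p + j))"
      by (simp add: sum.cartesian_product split_beta T_def mult_ac)
    finally show ?thesis by (simp add: lessThan_Suc_atMost)
  qed
  have "B f f = (\<Sum>k<n+1. \<Sum>i<p. \<Sum>k'<n+1. \<Sum>j<p. f (k * p + i) * T (k + k') $$ (i, j) * f (k' * p + j))"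
    unfolding B_def sum_blocks by (intro sum.cong refl) simp
  also have "\<dots> = (\<Sum>i<p. \<Sum>k<n+1. \<Sum>k'<n+1. \<Sum>j<p. f (k * p + i) * T (k + k') $$ (i, j) * f (k' * p + j))"
    by (rule sum.swap)
  also have "\<dots> = (\<Sum>i<p. \<Sum>k<n+1. \<Sum>j<p. \<Sum>k'<n+1. f (k * p + i) * T (k + k') $$ (i, j) * f (k' * p + j))"
    by (intro sum.cong refl sum.swap)
  also have "\<dots> = (\<Sum>i<p. \<Sum>j<p. \<Sum>k<n+1. \<Sum>k'<n+1. f (k * p + i) * T (k + k') $$ (i, j) * f (k' * p + j))"
    by (intro sum.cong refl sum.swap)
  also have "\<dots> = poly_form p L (tuple f)"
    unfolding poly_form_def by (intro sum.cong refl) (simp add: entry)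
  finally show ?thesis ..
qed

text \<open>The support condition makes the block of the power \<open>n\<close> vanish, so the
  product stays within degree \<open>n\<close> and no coefficient is lost.\<close>

lemma tuple_shift:
  assumes "f \<in> supported_below (n * p)" "i < p"
  shows "tuple (block_shift p f) i = [:- t, 1:] * tuple f i"
proof -
  have "f (n * p + i) = 0" using assms(1) by (simp add: supported_below_def)
  then have "[:- t, 1:] * tuple f i = (\<Sum>k<n. Polynomial.smult (f (k * p + i)) ([:- t, 1:] ^ Suc k))"
    unfolding tuple_def lessThan_Suc_atMost[symmetric] sum.lessThan_Suc
    by (simp only: smult_0_left add_0_right sum_distrib_left power_Suc mult_smult_right)
  also have "\<dots> = tuple (block_shift p f) i"
    unfolding tuple_def lessThan_Suc_atMost[symmetric] sum.lessThan_Suc_shift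
    using assms(2) by (simp add: block_shift_def)
  finally show ?thesis ..
qed

lemma degree_shift_tuple:
  "f \<in> supported_below (n * p) \<Longrightarrow> \<forall>i<p. degree ([:- t, 1:] * tuple f i) \<le> n"
  using tuple_shift degree_tuple by metis

lemma B_shift_left:
  "B (block_shift p f) g = (\<Sum>m<n * p. \<Sum>m'<(n + 1) * p.
     f m * T (Suc (m div p + m' div p)) $$ (m mod p, m' mod p) * g m')"
proof -
  have "B (block_shift p f) g = (\<Sum>m<n * p + p. block_shift p f m * (\<Sum>m'<(n + 1) * p.
      T (m div p + m' div p) $$ (m mod p, m' mod p) * g m'))"
    unfolding B_def by (simp add: sum_distrib_left mult.assoc add.commute)
  then show ?thesis unfolding sum_block_shift
    using p_pos by (simp add: sum_distrib_left mult.assoc)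
qed

lemma B_commute: "B f g = B g f"
proof -
  have "T (m div p + m' div p) $$ (m mod p, m' mod p) = T (m' div p + m div p) $$ (m' mod p, m mod p)"
    if "m < (n + 1) * p" "m' < (n + 1) * p" for m m'
  proof -
    have "m div p < n + 1" "m' div p < n + 1" using that by (simp_all add: less_mult_imp_div_less)
    then show ?thesis using T_symmetric[of "m div p + m' div p" "m mod p" "m' mod p"] p_pos
      by (simp add: add.commute)
  qed
  then have "B f g = (\<Sum>m<(n + 1) * p. \<Sum>m'<(n + 1) * p.
     g m' * T (m' div p + m div p) $$ (m' mod p, m mod p) * f m)"
    unfolding B_def by (intro sum.cong refl) simp
  also have "\<dots> = B g f" unfolding B_def by (rule sum.swap)
  finally show ?thesis .
qed

text \<open>Symmetry is the Hankel structure: shifting either argument raises the index of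
  \<open>T\<close> by one. Positivity and \<open>sh_null\<close> come from the representing
  measure.\<close>

sublocale truncated_shift B "n * p" "(n + 1) * p" "block_shift p"
proof
  fix f g h :: "nat \<Rightarrow> real" and c :: real
  show "B f g = B g f" by (rule B_commute)
  show "B (\<lambda>i. f i + g i) h = B f h + B g h"
    by (simp add: B_def distrib_right sum.distrib)
  show "B (\<lambda>i. c * f i) h = c * B f h"
    by (simp add: B_def sum_distrib_left mult.assoc)
  show "B f f \<ge> 0"
    unfolding poly_form_tuple[symmetric] using poly_form_nonneg[OF representing] degree_tuple by blast
  show "n * p \<le> (n + 1) * p" by simp
  show "block_shift p (\<lambda>i. f i + g i) = (\<lambda>i. block_shift p f i + block_shift p g i)"
    by (auto simp: block_shift_def)
  show "block_shift p (\<lambda>i. c * f i) = (\<lambda>i. c * block_shift p f i)"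
    by (auto simp: block_shift_def)
  assume f: "f \<in> supported_below (n * p)"
  then show "block_shift p f \<in> supported_below ((n + 1) * p)"
    by (auto simp: supported_below_def block_shift_def)
  show "B (block_shift p f) g = B f (block_shift p g)" if g: "g \<in> supported_below (n * p)"
  proof -
    have zero: "f' m = 0" if "f' \<in> supported_below (n * p)" "m \<notin> {..<n * p}" for f' m
      using that by (simp add: supported_below_def)
    have "B (block_shift p f') g' = (\<Sum>m<n * p. \<Sum>m'<n * p.
        f' m * T (Suc (m div p + m' div p)) $$ (m mod p, m' mod p) * g' m')"
      if "g' \<in> supported_below (n * p)" for f' g'
      unfolding B_shift_left using zero[OF that]
      by (intro sum.cong refl sum.mono_neutral_right) auto
    note eq = this
    have "B (block_shift p f) g = (\<Sum>m<n * p. \<Sum>m'<n * p.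
        g m' * T (Suc (m' div p + m div p)) $$ (m' mod p, m mod p) * f m)"
      unfolding eq[OF g]
    proof (intro sum.cong refl)
      fix m m' assume "m \<in> {..<n * p}" "m' \<in> {..<n * p}"
      then have "m div p < n" "m' div p < n" by (simp_all add: less_mult_imp_div_less)
      then show "f m * T (Suc (m div p + m' div p)) $$ (m mod p, m' mod p) * g m' =
          g m' * T (Suc (m' div p + m div p)) $$ (m' mod p, m mod p) * f m"
        using T_symmetric[of "Suc (m div p + m' div p)" "m mod p" "m' mod p"] p_pos
        by (simp add: add.commute)
    qed
    also have "\<dots> = B (block_shift p g) f" unfolding eq[OF f] by (rule sum.swap)
    finally show ?thesis by (simp add: B_commute)
  qed
  assume "B f f = 0"
  then have "poly_form p L (tuple f) = 0" by (simp add: poly_form_tuple)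
  moreover have "\<forall>i<p. degree ([:- t, 1:] * tuple f i) \<le> n"
    by (rule degree_shift_tuple[OF f])
  ultimately have "poly_form p L (\<lambda>i. [:- t, 1:] * tuple f i) = 0"
    using poly_form_null_mult[OF representing] degree_tuple by blast
  then have "poly_form p L (tuple (block_shift p f)) = 0"
    by (simp add: poly_form_def tuple_shift[OF f])
  then show "B (block_shift p f) (block_shift p f) = 0" by (simp add: poly_form_tuple)
qed

definition shift_injective :: bool where
  "shift_injective \<longleftrightarrow> (\<forall>f\<in>supported_below (n * p). B (block_shift p f) (block_shift p f) = 0 \<longrightarrow> B f f = 0)"

lemma shift_injective_if_not_atom:
  assumes \<mu>: "representing_measure n p L \<mu>" and t: "atom_mult \<mu> t = 0"
  shows shift_injective
  unfolding shift_injective_def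
proof (intro ballI impI)
  fix f assume f: "f \<in> supported_below (n * p)" and null: "B (block_shift p f) (block_shift p f) = 0"
  have "psd p (\<mu> {t})" using \<mu> by (auto simp: representing_measure_def positive_matrix_measure_def)
  then have "\<mu> {t} \<in> carrier_mat p p" by (simp add: psd_iff)
  then have "\<mu> {t} = 0\<^sub>m p p" using t rank_eq_0_imp_zero unfolding atom_mult_def by (metis carrier_matD(1))
  moreover have "poly_form p L (\<lambda>i. [:- t, 1:] * tuple f i) = 0"
    using null by (simp add: poly_form_tuple[symmetric] poly_form_def tuple_shift[OF f])
  moreover have "\<forall>i<p. degree ([:- t, 1:] * tuple f i) \<le> n"
    by (rule degree_shift_tuple[OF f])
  ultimately have "poly_form p L (tuple f) = 0"
    using poly_form_null_cancel[OF \<mu>] degree_tuple by blast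
  then show "B f f = 0" by (simp add: poly_form_tuple)
qed

end

subsection \<open>Kernels and columns of the moment matrix\<close>

context moment_problem
begin

abbreviation unit :: "nat \<Rightarrow> nat \<Rightarrow> real" where "unit m \<equiv> (\<lambda>j. of_bool (j = m))"

lemma B_rows: "B f g = (\<Sum>m<(n + 1) * p. f m *
    (\<Sum>m'<(n + 1) * p. T (m div p + m' div p) $$ (m mod p, m' mod p) * g m'))"
  unfolding B_def sum_distrib_left mult.assoc ..

lemma B_unit_left:
  assumes "m < (n + 1) * p"
  shows "B (unit m) g = (\<Sum>m'<(n + 1) * p. T (m div p + m' div p) $$ (m mod p, m' mod p) * g m')"
  using assms unfolding B_rows
  by (simp add: of_bool_def if_distrib[of "\<lambda>x. x * _"] cong: if_cong)

lemma B_unit: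
  assumes "m < (n + 1) * p" "m' < (n + 1) * p"
  shows "B (unit m) (unit m') = T (m div p + m' div p) $$ (m mod p, m' mod p)"
  using assms unfolding B_unit_left[OF assms(1)]
  by (simp add: of_bool_def if_distrib[of "\<lambda>x. _ * x"] cong: if_cong)

lemma B_expand: "B f g = (\<Sum>m<(n + 1) * p. f m * B (unit m) g)"
  unfolding B_rows[of f g] by (intro sum.cong refl) (simp add: B_unit_left)

lemma null_iff_units: "B f f = 0 \<longleftrightarrow> (\<forall>m<(n + 1) * p. B (unit m) f = 0)"
proof
  assume "B f f = 0"
  then show "\<forall>m<(n + 1) * p. B (unit m) f = 0" using null_orthogonal' by blast
next
  assume "\<forall>m<(n + 1) * p. B (unit m) f = 0"
  then show "B f f = 0" by (subst B_expand) simp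
qed

text \<open>Kernel vectors of a positive semidefinite Gram matrix are its null vectors. In the
  second matrix both arguments are shifted, whence the index \<open>i + 2\<close>.\<close>

lemma mem_kernel_iff:
  assumes v: "v \<in> carrier_vec (n * p)"
  defines "f \<equiv> (\<lambda>i. if i < n * p then v $ i else 0)"
  shows "v \<in> mat_kernel (block_hankel p n T) \<longleftrightarrow> B f f = 0"
    and "v \<in> mat_kernel (block_hankel p n (\<lambda>i. T (i + 2))) \<longleftrightarrow> B (block_shift p f) (block_shift p f) = 0"
proof -
  have fsum: "(\<Sum>m<(n + 1) * p. h m * f m) = (\<Sum>m<n * p. h m * v $ m)" for h
    by (rule sum.mono_neutral_cong_right) (auto simp: f_def)
  have kernel: "v \<in> mat_kernel (block_hankel p n S) \<longleftrightarrow>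
      (\<forall>m<n * p. (\<Sum>m'<n * p. S (m div p + m' div p) $$ (m mod p, m' mod p) * v $ m') = 0)" for S
  proof -
    have "v \<in> mat_kernel (block_hankel p n S) \<longleftrightarrow> block_hankel p n S *\<^sub>v v = 0\<^sub>v (n * p)"
      using v unfolding mat_kernel_def by (simp add: block_hankel_def)
    also have "\<dots> \<longleftrightarrow> (\<forall>m<n * p. (block_hankel p n S *\<^sub>v v) $ m = 0)"
      by (auto simp: vec_eq_iff block_hankel_def)
    finally show ?thesis
      using v by (simp add: block_hankel_def scalar_prod_def atLeast0LessThan)
  qed
  have M2: "B (unit m) f = (\<Sum>m'<n * p. T (m div p + m' div p) $$ (m mod p, m' mod p) * v $ m')"
    if "m < n * p" for m
  proof -
    have "m < (n + 1) * p" using that by simp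
    from B_unit_left[OF this, of f] show ?thesis unfolding fsum .
  qed
  have M3: "B (block_shift p (unit m)) (block_shift p f) =
      (\<Sum>m'<n * p. T (m div p + m' div p + 2) $$ (m mod p, m' mod p) * v $ m')"
    if "m < n * p" for m
  proof -
    have "B (block_shift p (unit m)) (block_shift p f) = (\<Sum>m'<n * p + p.
        T (Suc (m div p) + m' div p) $$ (m mod p, m' mod p) * block_shift p f m')"
      using that p_pos unfolding block_shift_unit by (subst B_unit_left) (simp_all add: add.commute)
    also have "\<dots> = (\<Sum>m'<n * p + p.
        block_shift p f m' * T (Suc (m div p) + m' div p) $$ (m mod p, m' mod p))"
      by (intro sum.cong refl mult.commute)
    also have "\<dots> = (\<Sum>m'<n * p. f m' * T (Suc (m div p) + (m' + p) div p) $$ (m mod p, (m' + p) mod p))"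
      by (rule sum_block_shift)
    also have "\<dots> = (\<Sum>m'<n * p. T (m div p + m' div p + 2) $$ (m mod p, m' mod p) * v $ m')"
      using p_pos by (intro sum.cong refl) (simp add: f_def mult.commute)
    finally show ?thesis .
  qed
  have ff: "B f f = (\<Sum>m<n * p. v $ m * B (unit m) f)"
  proof -
    have "B f f = (\<Sum>m<(n + 1) * p. B (unit m) f * f m)" by (subst B_expand) (simp only: mult.commute)
    then show ?thesis unfolding fsum by (simp only: mult.commute)
  qed
  show "v \<in> mat_kernel (block_hankel p n T) \<longleftrightarrow> B f f = 0"
  proof
    assume "v \<in> mat_kernel (block_hankel p n T)"
    then show "B f f = 0" unfolding kernel ff using M2 by simp
  next
    assume "B f f = 0"
    from null_orthogonal'[OF this] show "v \<in> mat_kernel (block_hankel p n T)"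
      unfolding kernel by (simp add: M2[symmetric])
  qed
  have "B (block_shift p f) (block_shift p f) = B (\<lambda>i. \<Sum>m<n * p. v $ m * block_shift p (unit m) i) (block_shift p f)"
  proof -
    have "block_shift p f i = (\<Sum>m<n * p. v $ m * block_shift p (unit m) i)" for i
      by (simp add: block_shift_def f_def of_bool_def if_distrib[of "\<lambda>x. _ * x"] cong: if_cong)
    then show ?thesis by (metis (no_types, lifting) ext)
  qed
  then have ss: "B (block_shift p f) (block_shift p f) = (\<Sum>m<n * p. v $ m * B (block_shift p (unit m)) (block_shift p f))"
    by (simp only: sum_left)
  show "v \<in> mat_kernel (block_hankel p n (\<lambda>i. T (i + 2))) \<longleftrightarrow> B (block_shift p f) (block_shift p f) = 0"
  proof
    assume "v \<in> mat_kernel (block_hankel p n (\<lambda>i. T (i + 2)))"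
    then show "B (block_shift p f) (block_shift p f) = 0" unfolding kernel ss using M3 by simp
  next
    assume "B (block_shift p f) (block_shift p f) = 0"
    from null_orthogonal'[OF this] show "v \<in> mat_kernel (block_hankel p n (\<lambda>i. T (i + 2)))"
      unfolding kernel by (simp add: M3[symmetric] del: add_2_eq_Suc')
  qed
qed

text \<open>The first kernel always lies in the second by \<open>sh_null\<close>; injectivity is the
  reverse inclusion.\<close>

lemma shift_injective_iff_kernels:
  "shift_injective \<longleftrightarrow> mat_kernel (block_hankel p n T) = mat_kernel (block_hankel p n (\<lambda>i. T (i + 2)))"
proof
  have carrier: "mat_kernel (block_hankel p n S) \<subseteq> carrier_vec (n * p)" for S
    by (auto simp: mat_kernel_def block_hankel_def)
  have supp: "(\<lambda>i. if i < n * p then v $ i else 0) \<in> supported_below (n * p)" for v :: "real vec"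
    by (simp add: supported_below_def)
  {
    assume shift_injective
    then show "mat_kernel (block_hankel p n T) = mat_kernel (block_hankel p n (\<lambda>i. T (i + 2)))"
      using carrier mem_kernel_iff sh_null[OF supp] supp unfolding shift_injective_def by blast
  next
    assume eq: "mat_kernel (block_hankel p n T) = mat_kernel (block_hankel p n (\<lambda>i. T (i + 2)))"
    show shift_injective
      unfolding shift_injective_def
    proof (intro ballI impI)
      fix f assume f: "f \<in> supported_below (n * p)" "B (block_shift p f) (block_shift p f) = 0"
      have "(\<lambda>i. if i < n * p then vec (n * p) f $ i else 0) = f"
        using f(1) by (auto simp: supported_below_def fun_eq_iff)
      then show "B f f = 0" using mem_kernel_iff[of "vec (n * p) f"] f(2) eq by simp
    qed
  }
qed

text \<open>The coefficients of a column relation form a null vector with leading coefficient 1.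
  Columns are counted from 1 and coefficients from 0, hence \<open>j - 1\<close>. The exception
  \<open>i \<noteq> j - 1\<close> matters for \<open>j < a\<close>: the range of columns is then
  empty, and \<open>f\<close> has to be the unit vector at \<open>j - 1\<close>.\<close>

lemma column_combination:
  fixes y comb
  defines "y \<equiv> (\<lambda>j. col (block_hankel p (n + 1) T) (j - 1))"
  defines "comb \<equiv> (\<lambda>\<gamma> J. finsum_vec TYPE(real) ((n + 1) * p) (\<lambda>l. \<gamma> l \<cdot>\<^sub>v y l) J)"
  assumes a: "a \<ge> 1" and j: "1 \<le> j" "j \<le> (n + 1) * p"
  shows "(\<exists>\<gamma>. y j = comb \<gamma> {a..j - 1}) \<longleftrightarrow>
    (\<exists>f. f (j - 1) = 1 \<and> f \<in> supported_below j \<and> (\<forall>i<a - 1. i \<noteq> j - 1 \<longrightarrow> f i = 0) \<and> B f f = 0)"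
proof -
  let ?N = "(n + 1) * p"
  have y: "y l \<in> carrier_vec ?N" for l
    by (intro carrier_vecI) (simp add: y_def block_hankel_def)
  have y_index: "y l $ m = B (unit m) (unit (l - 1))" if "m < ?N" "1 \<le> l" "l \<le> ?N" for l m
  proof -
    have "l - 1 < ?N" using that by simp
    then show ?thesis using that(1) B_unit[OF that(1) \<open>l - 1 < ?N\<close>] by (simp add: y_def block_hankel_def)
  qed
  define u where "u = (\<lambda>\<gamma> :: nat \<Rightarrow> real. \<lambda>i. unit (j - 1) i - (\<Sum>l\<in>{a..j - 1}. \<gamma> l * unit (l - 1) i))"
  have u: "u \<gamma> i = (if i = j - 1 then 1 else if a \<le> Suc i \<and> i < j - 1 then - \<gamma> (Suc i) else 0)" for \<gamma> i
  proof -
    have "(\<Sum>l\<in>{a..j - 1}. \<gamma> l * unit (l - 1) i) = (\<Sum>l\<in>{a..j - 1}. if Suc i = l then \<gamma> l else 0)"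
      using a by (intro sum.cong refl) auto
    also have "\<dots> = (if a \<le> Suc i \<and> i < j - 1 then \<gamma> (Suc i) else 0)"
      by (subst sum.delta') auto
    finally show ?thesis by (simp add: u_def)
  qed
  have comb_iff: "y j = comb \<gamma> {a..j - 1} \<longleftrightarrow> B (u \<gamma>) (u \<gamma>) = 0" for \<gamma>
  proof -
    have "comb \<gamma> {a..j - 1} \<in> carrier_vec ?N"
      unfolding comb_def using y by (intro finsum_vec_closed) auto
    then have "y j = comb \<gamma> {a..j - 1} \<longleftrightarrow> (\<forall>m<?N. y j $ m = comb \<gamma> {a..j - 1} $ m)"
      using carrier_vecD[OF y[of j]] carrier_vecD by (metis eq_vecI)
    also have "\<dots> \<longleftrightarrow> (\<forall>m<?N. B (unit m) (u \<gamma>) = 0)"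
    proof (intro all_cong)
      fix m assume m: "m < ?N"
      have "comb \<gamma> {a..j - 1} $ m = (\<Sum>l\<in>{a..j - 1}. (\<gamma> l \<cdot>\<^sub>v y l) $ m)"
        unfolding comb_def using m y by (intro index_finsum_vec) auto
      also have "\<dots> = (\<Sum>l\<in>{a..j - 1}. \<gamma> l * B (unit m) (unit (l - 1)))"
      proof (intro sum.cong refl)
        fix l assume "l \<in> {a..j - 1}"
        then have l: "1 \<le> l" "l \<le> ?N" using a j by auto
        have "m < dim_vec (y l)" using carrier_vecD[OF y[of l]] m by simp
        then show "(\<gamma> l \<cdot>\<^sub>v y l) $ m = \<gamma> l * B (unit m) (unit (l - 1))"
          unfolding y_index[OF m l, symmetric] by (rule index_smult_vec(1))
      qed
      finally show "y j $ m = comb \<gamma> {a..j - 1} $ m \<longleftrightarrow> B (unit m) (u \<gamma>) = 0"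
        unfolding u_def diff_right sum_right using y_index[OF m j] by simp
    qed
    finally show ?thesis unfolding null_iff_units .
  qed
  show ?thesis
  proof
    assume "\<exists>\<gamma>. y j = comb \<gamma> {a..j - 1}"
    then obtain \<gamma> where "B (u \<gamma>) (u \<gamma>) = 0" using comb_iff by blast
    moreover have "u \<gamma> (j - 1) = 1" "u \<gamma> \<in> supported_below j" "\<forall>i<a - 1. i \<noteq> j - 1 \<longrightarrow> u \<gamma> i = 0"
      using j by (auto simp: u supported_below_def)
    ultimately show "\<exists>f. f (j - 1) = 1 \<and> f \<in> supported_below j \<and> (\<forall>i<a - 1. i \<noteq> j - 1 \<longrightarrow> f i = 0) \<and> B f f = 0"
      by blast
  next
    assume "\<exists>f. f (j - 1) = 1 \<and> f \<in> supported_below j \<and> (\<forall>i<a - 1. i \<noteq> j - 1 \<longrightarrow> f i = 0) \<and> B f f = 0"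
    then obtain f where f: "f (j - 1) = 1" "f \<in> supported_below j" "\<forall>i<a - 1. i \<noteq> j - 1 \<longrightarrow> f i = 0" "B f f = 0"
      by blast
    have "u (\<lambda>l. - f (l - 1)) i = f i" for i
    proof -
      have "f i = 0" if "i \<noteq> j - 1" "\<not> (a \<le> Suc i \<and> i < j - 1)"
        using f(2,3) that by (cases "i < a - 1") (auto simp: supported_below_def)
      then show ?thesis using f(1) by (auto simp: u)
    qed
    then have uf: "u (\<lambda>l. - f (l - 1)) = f" by (rule ext)
    show "\<exists>\<gamma>. y j = comb \<gamma> {a..j - 1}"
      by (rule exI[of _ "\<lambda>l. - f (l - 1)"]) (unfold comb_iff uf, rule f(4))
  qed
qed

text \<open>A kernel vector of the shift with least leading index cannot be reduced by a null vector, so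
  its leading column is a pivot whose shift by one block is dependent on its shifted predecessors.\<close>

lemma shift_injective_iff_columns:
  fixes y comb
  defines "y \<equiv> (\<lambda>j. col (block_hankel p (n + 1) T) (j - 1))"
  defines "comb \<equiv> (\<lambda>\<gamma> J. finsum_vec TYPE(real) ((n + 1) * p) (\<lambda>l. \<gamma> l \<cdot>\<^sub>v y l) J)"
  defines "A \<equiv> {i \<in> {1..p}. \<exists>k \<in> {1..n}.
      (\<exists>\<gamma> :: nat \<Rightarrow> real. y (k * p + i) = comb \<gamma> {p + 1..k * p + i - 1}) \<and>
      (\<forall>\<delta> :: nat \<Rightarrow> real. y ((k - 1) * p + i) \<noteq> comb \<delta> {1..(k - 1) * p + i - 1})}"
  shows "shift_injective \<longleftrightarrow> A = {}"
proof -
  define lead where "lead = (\<lambda>m f. f m = (1::real) \<and> f \<in> supported_below (Suc m))"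
  have A_iff: "i \<in> A \<longleftrightarrow> i \<in> {1..p} \<and> (\<exists>k\<in>{1..n}.
      (\<exists>f. lead ((k - 1) * p + (i - 1)) f \<and> B (block_shift p f) (block_shift p f) = 0) \<and>
      \<not> (\<exists>f. lead ((k - 1) * p + (i - 1)) f \<and> B f f = 0))" for i
  proof -
    have "(\<exists>\<gamma>. y (k * p + i) = comb \<gamma> {p + 1..k * p + i - 1}) \<longleftrightarrow>
        (\<exists>f. lead ((k - 1) * p + (i - 1)) f \<and> B (block_shift p f) (block_shift p f) = 0)" (is "?l \<longleftrightarrow> ?r")
      and "(\<exists>\<gamma>. y ((k - 1) * p + i) = comb \<gamma> {1..(k - 1) * p + i - 1}) \<longleftrightarrow>
        (\<exists>f. lead ((k - 1) * p + (i - 1)) f \<and> B f f = 0)" (is "?l' \<longleftrightarrow> ?r'")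
      if i: "i \<in> {1..p}" and k: "k \<in> {1..n}" for k
    proof -
      \<comment> \<open>The position, counted from 0, of column \<open>(k - 1) * p + i\<close>; one
        block later it is \<open>m + p\<close>.\<close>
      define m where "m = (k - 1) * p + (i - 1)"
      have kp: "k * p = (k - 1) * p + p" using k by (cases k) auto
      have m: "Suc m = (k - 1) * p + i" "Suc m + p = k * p + i" "m + p = k * p + i - 1"
        using i kp by (auto simp: m_def)
      have "k * p + i \<le> n * p + p" using k i by (intro add_mono mult_le_mono1) auto
      then have le: "k * p + i \<le> (n + 1) * p" by simp
      have "?l' \<longleftrightarrow> (\<exists>f. f m = 1 \<and> f \<in> supported_below (Suc m) \<and> B f f = 0)"
      proof -
        have "Suc m \<le> (n + 1) * p" using le kp m(1) by linarith
        then show ?thesis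
          using column_combination[of 1 "Suc m"] unfolding y_def comb_def m(1)[symmetric] by simp
      qed
      then show "?l' \<longleftrightarrow> ?r'" by (simp add: lead_def m_def)
      have "?l \<longleftrightarrow> (\<exists>f. f (m + p) = 1 \<and> f \<in> supported_below (Suc m + p) \<and>
          (\<forall>i<p. f i = 0) \<and> B f f = 0)"
      proof -
        have "Suc m + p \<le> (n + 1) * p" using le m(2) by linarith
        moreover have "(\<forall>i<p. i \<noteq> m + p \<longrightarrow> f i = 0) \<longleftrightarrow> (\<forall>i<p. f i = 0)" for f :: "nat \<Rightarrow> real"
          by auto
        ultimately show ?thesis
          using column_combination[of "p + 1" "Suc m + p"] unfolding y_def comb_def m(2)[symmetric] by simp
      qed
      also have "\<dots> \<longleftrightarrow> (\<exists>f. lead m f \<and> B (block_shift p f) (block_shift p f) = 0)"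
      proof (intro iffI; elim exE conjE)
        fix f assume f: "f (m + p) = 1" "f \<in> supported_below (Suc m + p)" "\<forall>i<p. f i = 0" "B f f = 0"
        have "block_shift p (\<lambda>i. f (i + p)) = f" using f(3) by (auto simp: block_shift_def fun_eq_iff)
        moreover have "lead m (\<lambda>i. f (i + p))" using f(1,2) by (auto simp: lead_def supported_below_def)
        ultimately show "\<exists>f. lead m f \<and> B (block_shift p f) (block_shift p f) = 0" using f(4) by metis
      next
        fix f assume f: "lead m f" "B (block_shift p f) (block_shift p f) = 0"
        have "block_shift p f (m + p) = 1" "block_shift p f \<in> supported_below (Suc m + p)"
          "\<forall>i<p. block_shift p f i = 0"
          using f(1) by (auto simp: block_shift_def lead_def supported_below_def)
        then show "\<exists>f. f (m + p) = 1 \<and> f \<in> supported_below (Suc m + p) \<and> (\<forall>i<p. f i = 0) \<and> B f f = 0"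
          using f(2) by blast
      qed
      finally show "?l \<longleftrightarrow> ?r" by (simp add: m_def)
    qed
    then show ?thesis unfolding A_def by blast
  qed
  show ?thesis
  proof
    assume inj: shift_injective
    have "i \<notin> A" for i
    proof
      assume "i \<in> A"
      then obtain k f where ik: "i \<in> {1..p}" "k \<in> {1..n}"
        and f: "lead ((k - 1) * p + (i - 1)) f" "B (block_shift p f) (block_shift p f) = 0"
        and no: "\<not> (\<exists>f. lead ((k - 1) * p + (i - 1)) f \<and> B f f = 0)"
        unfolding A_iff by blast
      have "k * p \<le> n * p" using ik(2) by (intro mult_le_mono1) simp
      moreover have "k * p = (k - 1) * p + p" using ik(2) by (cases k) auto
      ultimately have "Suc ((k - 1) * p + (i - 1)) \<le> n * p" using ik by auto
      then have "f \<in> supported_below (n * p)" using f(1) supported_below_mono unfolding lead_def by blast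
      then show False using inj f no unfolding shift_injective_def by blast
    qed
    then show "A = {}" by blast
  next
    assume empty: "A = {}"
    have "B f f = 0" if "m \<le> n * p" "f \<in> supported_below m" "B (block_shift p f) (block_shift p f) = 0" for m f
      using that
    proof (induction m arbitrary: f)
      case 0
      then have "f = (\<lambda>i. 0)" by (auto simp: supported_below_def)
      then show ?case by (simp add: zero_left)
    next
      case (Suc m)
      show ?case
      proof (cases "f m = 0")
        case True
        have "f i = 0" if "i \<ge> m" for i
          using True Suc.prems(2) that by (cases "i = m") (auto simp: supported_below_def)
        then have "f \<in> supported_below m" by (simp add: supported_below_def)
        then show ?thesis using Suc by simp
      next
        case False
        define g where "g = (\<lambda>i. (1 / f m) * f i)"
        have g: "lead m g" using False Suc.prems(2) by (simp add: lead_def g_def supported_below_def)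
        have "B (block_shift p g) (block_shift p g) = 0"
          unfolding g_def sh_scale scale_left scale_right using Suc.prems(3) by simp
        moreover define k i where "k = m div p + 1" and "i = m mod p + 1"
        have "m div p < n" using Suc.prems(1) by (simp add: less_mult_imp_div_less)
        then have "k \<in> {1..n}" "i \<in> {1..p}" "(k - 1) * p + (i - 1) = m"
          using p_pos by (auto simp: k_def i_def Suc_le_eq)
        \<comment> \<open>As \<open>A\<close> is empty, \<open>m\<close> is not a pivot killed by
          the shift, so \<open>g\<close> forces a null vector with the same leading index.\<close>
        ultimately obtain h where h: "lead m h" "B h h = 0"
          using g empty A_iff[of i] by fastforce
        have h_supp: "h \<in> supported_below (n * p)"
          using h(1) Suc.prems(1) supported_below_mono unfolding lead_def by blast
        \<comment> \<open>Subtracting a multiple of \<open>h\<close> lowers the support bound, keeps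
          the shift null and changes \<open>f\<close> only by a null vector.\<close>
        define d where "d = (\<lambda>i. f i + (- f m) * h i)"
        have "d i = 0" if "i \<ge> m" for i
          using that h(1) Suc.prems(2)
          by (cases "i = m") (auto simp: d_def lead_def supported_below_def)
        then have d_supp: "d \<in> supported_below m" by (simp add: supported_below_def)
        have "B (block_shift p d) (block_shift p d) = 0"
          unfolding d_def sh_add sh_scale add_left scale_left
          using null_orthogonal[OF Suc.prems(3)] null_orthogonal[OF sh_null[OF h_supp h(2)]] by simp
        then have "B d d = 0" using Suc.IH[OF _ d_supp] Suc.prems(1) by simp
        then have "B d f = 0" by (rule null_orthogonal)
        then show ?thesis
          unfolding d_def add_left scale_left using null_orthogonal[OF h(2)] by simp
      qed
    qed
    then show shift_injective unfolding shift_injective_def by blast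
  qed
qed

end

subsection \<open>Minimal measures avoiding a point\<close>

context moment_problem
begin

text \<open>Powers of \<open>x - t\<close> are monic of every degree, so subtracting a multiple of
  one removes the leading coefficient of \<open>f\<close>, and induction on the degree
  applies.\<close>

lemma L_eval_of_moments:
  assumes T: "\<And>q i j. q \<le> 2 * n \<Longrightarrow> i < p \<Longrightarrow> j < p \<Longrightarrow> T q $$ (i, j) = (\<Sum>k\<in>K. (x k - t) ^ q * C k i j)"
    and f: "degree f \<le> 2 * n" and ij: "i < p" "j < p"
  shows "L f $$ (i, j) = (\<Sum>k\<in>K. poly f (x k) * C k i j)"
proof -
  have "degree f \<le> d \<Longrightarrow> d \<le> 2 * n \<Longrightarrow> L f $$ (i, j) = (\<Sum>k\<in>K. poly f (x k) * C k i j)" for d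
  proof (induction d arbitrary: f)
    case 0
    then obtain a where a: "f = [:a:]" using degree_eq_zeroE by auto
    have "L (\<Sum>k\<in>{0::nat}. Polynomial.smult a ([:- t, 1:] ^ k)) $$ (i, j) = (\<Sum>k\<in>{0::nat}. a * L ([:- t, 1:] ^ k) $$ (i, j))"
      by (rule L_sum[THEN conjunct2]) (use ij in auto)
    then have "L f $$ (i, j) = a * T 0 $$ (i, j)" by (simp add: a T_def)
    then show ?case using T[of 0 i j] ij by (simp add: a sum_distrib_left)
  next
    case (Suc d)
    define a where "a = coeff f (Suc d)"
    define g where "g = f - Polynomial.smult a ([:- t, 1:] ^ Suc d)"
    have lin: "degree ([:- t, 1:] ^ Suc d) = Suc d" by (rule degree_linear_power)
    have "coeff ([:- t, 1:] ^ Suc d) (Suc d) = 1"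
      using monic_power[of "[:- t, 1:]" "Suc d"] lin by simp
    then have "coeff g (Suc d) = 0" by (simp add: g_def a_def del: power_Suc)
    moreover have "degree g \<le> Suc d"
      unfolding g_def using Suc.prems(1) lin
      by (intro degree_diff_le) (auto intro: order_trans[OF degree_smult_le] simp del: power_Suc)
    ultimately have g: "degree g \<le> d"
      by (metis eq_zero_or_degree_less le_SucE less_Suc_eq_le degree_0 le0)
    have IH: "L g $$ (i, j) = (\<Sum>k\<in>K. poly g (x k) * C k i j)"
      by (rule Suc.IH[OF g]) (use Suc.prems in simp)
    let ?G = "\<lambda>k :: nat. if k = 0 then g else [:- t, 1:] ^ Suc d"
    let ?c = "\<lambda>k :: nat. if k = 0 then 1 else a"
    have "L (\<Sum>k\<in>{0, 1}. Polynomial.smult (?c k) (?G k)) $$ (i, j) = (\<Sum>k\<in>{0, 1}. ?c k * L (?G k) $$ (i, j))"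
      by (rule L_sum[THEN conjunct2]) (use ij g lin Suc.prems(2) in \<open>auto simp del: power_Suc\<close>)
    then have "L f $$ (i, j) = L g $$ (i, j) + a * T (Suc d) $$ (i, j)"
      by (simp add: g_def T_def del: power_Suc)
    also have "T (Suc d) $$ (i, j) = (\<Sum>k\<in>K. (x k - t) ^ Suc d * C k i j)"
      using Suc.prems(2) ij by (intro T) auto
    also have "L g $$ (i, j) + a * \<dots> = (\<Sum>k\<in>K. (poly g (x k) + a * (x k - t) ^ Suc d) * C k i j)"
      unfolding IH by (simp add: distrib_right sum.distrib sum_distrib_left mult.assoc)
    also have "\<dots> = (\<Sum>k\<in>K. poly f (x k) * C k i j)"
    proof -
      have "poly ([:- t, 1:] ^ Suc d) y = (y - t) ^ Suc d" for y
        unfolding poly_power by simp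
      then show ?thesis by (simp add: g_def del: power_Suc)
    qed
    finally show ?case .
  qed
  then show ?thesis using f by blast
qed

lemma shift_injective_imp_not_atom:
  assumes shift_injective
  shows "\<exists>\<mu>. minimal_representing_measure n p L \<mu> \<and> atom_mult \<mu> t = 0"
proof -
  let ?N = "(n + 1) * p"
  obtain es z where es: "orthonormal es" "set es \<subseteq> supported_below ?N" "complete_below ?N es"
    and z: "\<And>k. k < length es \<Longrightarrow> z k \<noteq> 0"
    "\<And>k f. k < length es \<Longrightarrow> f \<in> supported_below (n * p) \<Longrightarrow> B (block_shift p f) (es ! k) = z k * B f (es ! k)"
    using invertible_extension assms unfolding shift_injective_def by metis
  define r where "r = length es"
  define x where "x = (\<lambda>k. t + z k)"
  define a where "a = (\<lambda>k i. B (unit i) (es ! k))"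
  \<comment> \<open>Each factor \<open>x - t\<close> crosses over as a factor \<open>z k\<close>;
    the bound \<open>q \<le> n\<close> keeps every vector that is shifted in the domain.\<close>
  have coord: "B (unit (q * p + i)) (es ! k) = z k ^ q * a k i" if "k < r" "q \<le> n" "i < p" for k q i
    using that(2)
  proof (induction q)
    case 0
    then show ?case by (simp add: a_def)
  next
    case (Suc q)
    have "q * p + i < Suc q * p" using that(3) by simp
    also have "\<dots> \<le> n * p" using Suc.prems by (intro mult_le_mono1)
    finally have u: "unit (q * p + i) \<in> supported_below (n * p)" by (rule supported_below_unit)
    have "unit (Suc q * p + i) = block_shift p (unit (q * p + i))"
      unfolding block_shift_unit by (simp add: add_ac)
    then show ?case using z(2)[OF _ u, of k] that(1) Suc by (simp add: r_def)
  qed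
  have coord': "B (unit m) (es ! k) = z k ^ (m div p) * a k (m mod p)" if "k < r" "m < ?N" for k m
  proof -
    have "m div p \<le> n" "m mod p < p" using that(2) p_pos less_mult_imp_div_less[of m "n + 1" p] by simp_all
    from coord[OF that(1) this] show ?thesis by simp
  qed
  \<comment> \<open>A relation among the pairings makes \<open>?g\<close> orthogonal to all unit
    vectors, hence to \<open>es ! k\<close>, whose pairing with \<open>?g\<close> is
    \<open>c k\<close>.\<close>
  have indep: "\<forall>k<r. c k = 0" if c: "\<And>m. m < ?N \<Longrightarrow> (\<Sum>k<r. c k * B (unit m) (es ! k)) = 0" for c
  proof (intro allI impI)
    fix k assume k: "k < r"
    let ?g = "\<lambda>i. \<Sum>k<length es. c k * (es ! k) i"
    have "B (unit m) ?g = 0" if "m < ?N" for m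
      unfolding sum_right using c[OF that] by (simp add: r_def)
    then have "B (es ! k) ?g = 0" by (subst B_expand) simp
    then show "c k = 0" using orthonormal_sum[OF es(1), of k c] k commute by (simp add: r_def)
  qed
  have lt: "w * p + h < ?N" if "w \<le> n" "h < p" for w h
  proof -
    have "w * p + h < n * p + p" using that by (intro add_le_less_mono mult_le_mono1)
    then show ?thesis by simp
  qed
  have T: "T q $$ (i, j) = (\<Sum>k<r. (x k - t) ^ q * (a k i * a k j))" if q: "q \<le> 2 * n" and ij: "i < p" "j < p" for q i j
  proof -
    \<comment> \<open>An order up to \<open>2 * n\<close> splits into two parts of at most
      \<open>n\<close>, so the moment is a pairing of two basis vectors and the Fourier expansion in
      \<open>es\<close> applies.\<close>
    define u v where "u = min q n" and "v = q - u"
    have uv: "u \<le> n" "v \<le> n" "u + v = q" using q by (auto simp: u_def v_def)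
    have "T q $$ (i, j) = B (unit (u * p + i)) (unit (v * p + j))"
      using B_unit[OF lt[OF uv(1) ij(1)] lt[OF uv(2) ij(2)]] ij uv(3) by simp
    also have "\<dots> = B (\<lambda>h. \<Sum>k<length es. B (unit (u * p + i)) (es ! k) * (es ! k) h) (unit (v * p + j))"
      by (rule null_diff_cong[OF fourier_left[OF es supported_below_unit[OF lt[OF uv(1) ij(1)]]]])
    also have "\<dots> = (\<Sum>k<r. B (unit (u * p + i)) (es ! k) * B (unit (v * p + j)) (es ! k))"
      unfolding sum_left r_def by (simp add: commute)
    also have "\<dots> = (\<Sum>k<r. z k ^ q * (a k i * a k j))"
      using coord uv ij by (intro sum.cong refl) (simp add: uv(3)[symmetric] power_add)
    finally show ?thesis by (simp add: x_def)
  qed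
  have L: "L f $$ (i, j) = (\<Sum>k<r. poly f (x k) * (a k i * a k j))" if "degree f \<le> 2 * n" "i < p" "j < p" for f i j
    using L_eval_of_moments[OF T that] .
  have rank_moment: "mat_rank (moment_matrix n p L) = r"
  proof -
    let ?b = "\<lambda>k m. x k ^ (m div p) * a k (m mod p)"
    have "moment_matrix n p L = mat ?N ?N (\<lambda>(m, m'). \<Sum>k\<in>{..<r}. ?b k m * ?b k m')"
    proof (rule eq_matI)
      fix m m' assume m: "m < dim_row (mat ?N ?N (\<lambda>(m, m'). \<Sum>k\<in>{..<r}. ?b k m * ?b k m'))"
        "m' < dim_col (mat ?N ?N (\<lambda>(m, m'). \<Sum>k\<in>{..<r}. ?b k m * ?b k m'))"
      then have "m div p < n + 1" "m' div p < n + 1" by (simp_all add: less_mult_imp_div_less)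
      then have "degree (monom (1 :: real) (m div p + m' div p)) \<le> 2 * n"
        by (intro order_trans[OF degree_monom_le]) simp
      from L[OF this] m p_pos show "moment_matrix n p L $$ (m, m') =
          mat ?N ?N (\<lambda>(m, m'). \<Sum>k\<in>{..<r}. ?b k m * ?b k m') $$ (m, m')"
        by (simp add: moment_matrix_def block_hankel_def poly_monom power_add mult_ac)
    qed (simp_all add: moment_matrix_def block_hankel_def)
    also have "mat_rank \<dots> = card {..<r}"
    proof (rule rank_sum_outer_set)
      fix c assume c: "\<And>m. m < ?N \<Longrightarrow> (\<Sum>k<r. c k * (x k ^ (m div p) * a k (m mod p))) = 0"
      have monomial: "(\<Sum>k<r. c k * (x k ^ q * a k i)) = 0" if "q \<le> n" "i < p" for q i
      proof -
        show ?thesis using c[OF lt[OF that]] that by simp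
      qed
      \<comment> \<open>The moment matrix uses powers of \<open>x\<close>, whereas
        \<open>indep\<close> concerns powers of \<open>x - t\<close>. Polynomials of degree at most
        \<open>n\<close> translate between the two.\<close>
      have polynomial: "(\<Sum>k<r. c k * (poly f (x k) * a k i)) = 0" if "degree f \<le> n" "i < p" for f i
      proof -
        have "poly f y = (\<Sum>q\<le>n. coeff f q * y ^ q)" for y
          unfolding poly_altdef using that(1) by (intro sum.mono_neutral_left) (auto simp: coeff_eq_0)
        then have "(\<Sum>k<r. c k * (poly f (x k) * a k i)) = (\<Sum>k<r. \<Sum>q\<le>n. coeff f q * (c k * (x k ^ q * a k i)))"
          by (simp add: sum_distrib_left sum_distrib_right mult_ac)
        also have "\<dots> = (\<Sum>q\<le>n. \<Sum>k<r. coeff f q * (c k * (x k ^ q * a k i)))" by (rule sum.swap)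
        also have "\<dots> = 0" using monomial that(2) by (simp add: sum_distrib_left[symmetric])
        finally show ?thesis .
      qed
      have "\<forall>k<r. c k = 0"
      proof (rule indep)
        fix m assume m: "m < ?N"
        then have "m div p \<le> n" "m mod p < p" using p_pos less_mult_imp_div_less[of m "n + 1" p] by simp_all
        then show "(\<Sum>k<r. c k * B (unit m) (es ! k)) = 0"
          using polynomial[of "[:- t, 1:] ^ (m div p)" "m mod p"] coord'[OF _ m] degree_power_le
          by (simp add: poly_power x_def)
      qed
      then show "\<forall>k\<in>{..<r}. c k = 0" by simp
    qed simp
    finally show ?thesis by simp
  qed
  obtain \<xi> where \<xi>: "bij_betw \<xi> {..<card (x ` {..<r})} (x ` {..<r})"
    using ex_bij_betw_nat_finite[of "x ` {..<r}"] by (auto simp: atLeast0LessThan)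
  define l where "l = card (x ` {..<r})"
  have \<xi>: "bij_betw \<xi> {..<l} (x ` {..<r})" using \<xi> by (simp add: l_def)
  \<comment> \<open>Eigenvalues may repeat while atoms must be distinct, so the rank-one masses at a
    common node are added up.\<close>
  define K where "K = (\<lambda>j. {k \<in> {..<r}. x k = \<xi> j})"
  define A where "A = (\<lambda>j. mat p p (\<lambda>(i, i'). \<Sum>k\<in>K j. a k i * a k i'))"
  have regroup: "(\<Sum>j<l. \<Sum>k\<in>K j. h k) = (\<Sum>k<r. h k)" for h :: "nat \<Rightarrow> 'x :: comm_monoid_add"
  proof -
    have "(\<Sum>j<l. \<Sum>k\<in>K j. h k) = (\<Sum>y\<in>x ` {..<r}. \<Sum>k\<in>{k \<in> {..<r}. x k = y}. h k)"
      unfolding K_def by (rule sum.reindex_bij_betw[OF \<xi>])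
    also have "\<dots> = (\<Sum>k<r. h k)" by (rule sum.group) auto
    finally show ?thesis .
  qed
  have A_psd: "psd p (A j)" for j
    unfolding psd_iff
  proof (intro conjI allI impI)
    show "A j \<in> carrier_mat p p" by (simp add: A_def)
    show "A j $$ (i, i') = A j $$ (i', i)" if "i < p" "i' < p" for i i'
      using that by (simp add: A_def mult.commute)
    fix v
    have "(\<Sum>i<p. \<Sum>i'<p. v i * v i' * A j $$ (i, i')) = (\<Sum>i<p. \<Sum>i'<p. \<Sum>k\<in>K j. (v i * a k i) * (v i' * a k i'))"
      by (intro sum.cong refl) (simp add: A_def sum_distrib_left mult_ac)
    also have "\<dots> = (\<Sum>i<p. \<Sum>k\<in>K j. \<Sum>i'<p. (v i * a k i) * (v i' * a k i'))"
      by (intro sum.cong refl sum.swap)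
    also have "\<dots> = (\<Sum>k\<in>K j. \<Sum>i<p. \<Sum>i'<p. (v i * a k i) * (v i' * a k i'))"
      by (rule sum.swap)
    also have "\<dots> = (\<Sum>k\<in>K j. (\<Sum>i<p. v i * a k i)\<^sup>2)"
      by (simp add: power2_eq_square sum_product)
    also have "\<dots> \<ge> 0" by (intro sum_nonneg) simp
    finally show "0 \<le> (\<Sum>i<p. \<Sum>i'<p. v i * v i' * A j $$ (i, i'))" .
  qed
  \<comment> \<open>At one node all \<open>z k\<close> agree, so a relation among the
    \<open>a k\<close> scales to a relation among all coordinates and is trivial by
    \<open>indep\<close>. No rank is lost by grouping.\<close>
  have A_rank: "mat_rank (A j) = card (K j)" for j
    unfolding A_def
  proof (rule rank_sum_outer_set)
    show "finite (K j)" by (simp add: K_def)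
    fix c assume c: "\<And>i. i < p \<Longrightarrow> (\<Sum>k\<in>K j. c k * a k i) = 0"
    define d where "d = (\<lambda>k. if k \<in> K j then c k else 0)"
    have "\<forall>k<r. d k = 0"
    proof (rule indep)
      fix m assume m: "m < ?N"
      have "(\<Sum>k<r. d k * B (unit m) (es ! k)) = (\<Sum>k\<in>K j. c k * B (unit m) (es ! k))"
        by (rule sum.mono_neutral_cong_right) (auto simp: K_def d_def)
      also have "\<dots> = (\<Sum>k\<in>K j. (\<xi> j - t) ^ (m div p) * (c k * a k (m mod p)))"
      proof (intro sum.cong refl)
        fix k assume k: "k \<in> K j"
        then have "z k = \<xi> j - t" by (simp add: K_def x_def)
        then show "c k * B (unit m) (es ! k) = (\<xi> j - t) ^ (m div p) * (c k * a k (m mod p))"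
          using coord'[OF _ m, of k] k by (simp add: K_def)
      qed
      also have "\<dots> = 0" using c[of "m mod p"] p_pos by (simp add: sum_distrib_left[symmetric])
      finally show "(\<Sum>k<r. d k * B (unit m) (es ! k)) = 0" .
    qed
    then show "\<forall>k\<in>K j. c k = 0" by (auto simp: d_def K_def)
  qed
  have A_nz: "A j \<noteq> 0\<^sub>m p p" if "j < l" for j
  proof
    assume zero: "A j = 0\<^sub>m p p"
    have "\<xi> j \<in> x ` {..<r}" using \<xi> that by (auto simp: bij_betw_def)
    then have "K j \<noteq> {}" "finite (K j)" by (auto simp: K_def)
    then have "mat_rank (A j) > 0" unfolding A_rank by (simp add: card_gt_0_iff)
    moreover have "mat_rank (0\<^sub>m p p) = 0" using vec_space.rank_0I[of p p] by simp
    ultimately show False unfolding zero by simp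
  qed
  define \<mu> where "\<mu> = atomic_matrix_measure p l \<xi> A"
  have inj: "inj_on \<xi> {..<l}" using \<xi> by (simp add: bij_betw_def)
  have "representing_measure n p L \<mu>"
    unfolding representing_measure_def
  proof (intro conjI allI impI)
    show "positive_matrix_measure p \<mu>" unfolding \<mu>_def by (rule positive_atomic[OF inj A_psd])
    fix f :: "real poly" assume f: "degree f \<le> 2 * n"
    show "matrix_integrable p \<mu> f" unfolding \<mu>_def by (rule matrix_integrable_atomic[OF inj A_psd])
    have "(\<Sum>j<l. poly f (\<xi> j) * A j $$ (i, i')) = L f $$ (i, i')" if "i < p" "i' < p" for i i'
    proof -
      have "(\<Sum>j<l. poly f (\<xi> j) * A j $$ (i, i')) = (\<Sum>j<l. \<Sum>k\<in>K j. poly f (x k) * (a k i * a k i'))"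
        using that by (intro sum.cong refl) (simp add: A_def sum_distrib_left K_def)
      then show ?thesis using L[OF f that] regroup by simp
    qed
    moreover have "L f \<in> carrier_mat p p"
      using linear f unfolding linear_operator_def sym_mats_def by blast
    ultimately show "L f = matrix_integral p \<mu> f"
      unfolding \<mu>_def matrix_integral_atomic[OF inj A_psd] by (intro eq_matI) auto
  qed
  moreover have "(\<Sum>j<l. mat_rank (A j)) = mat_rank (moment_matrix n p L)"
    unfolding A_rank rank_moment using regroup[of "\<lambda>k. 1 :: nat"] by simp
  ultimately have "minimal_representing_measure n p L \<mu>"
    unfolding minimal_representing_measure_def
    using inj A_psd A_nz by (intro conjI exI[of _ l] exI[of _ \<xi>] exI[of _ A]) (auto simp: \<mu>_def atomic_matrix_measure_def)
  moreover have "atom_mult \<mu> t = 0"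
  proof -
    have "\<xi> j \<noteq> t" if "j < l" for j
    proof -
      have "\<xi> j \<in> x ` {..<r}" using \<xi> that by (auto simp: bij_betw_def)
      then show ?thesis using z(1) by (auto simp: x_def r_def)
    qed
    then have "\<mu> {t} = 0\<^sub>m p p"
      by (intro eq_matI) (auto simp: \<mu>_def atomic_matrix_measure_def measure_return)
    then show ?thesis using vec_space.rank_0I[of p p] by (simp add: atom_mult_def)
  qed
  ultimately show ?thesis by blast
qed

end

theorem theorem1p3:
  fixes n p :: nat
    and L :: "real poly \<Rightarrow> real mat"
    and t :: real
  assumes "n \<ge> 1" and "p \<ge> 1"
    and "linear_operator (2 * n) p L"
    and "\<exists>\<mu>. representing_measure n p L \<mu>"
  defines "T \<equiv> (\<lambda>i. L ([:- t, 1:] ^ i))"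
  defines "M1 \<equiv> block_hankel p (n + 1) T"
    and "M2 \<equiv> block_hankel p n T"
    and "M3 \<equiv> block_hankel p n (\<lambda>i. T (i + 2))"
  defines "y \<equiv> (\<lambda>j. col M1 (j - 1))"
  defines "comb \<equiv> (\<lambda>\<gamma> J. finsum_vec TYPE(real) ((n + 1) * p) (\<lambda>l. \<gamma> l \<cdot>\<^sub>v y l) J)"
  defines "A \<equiv> {i \<in> {1..p}. \<exists>k \<in> {1..n}.
      (\<exists>\<gamma> :: nat \<Rightarrow> real. y (k * p + i) = comb \<gamma> {p + 1..k * p + i - 1}) \<and>
      (\<forall>\<delta> :: nat \<Rightarrow> real. y ((k - 1) * p + i) \<noteq> comb \<delta> {1..(k - 1) * p + i - 1})}"
  shows "((\<exists>\<mu>. minimal_representing_measure n p L \<mu> \<and> atom_mult \<mu> t = 0) \<longleftrightarrow> A = {})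
       \<and> (A = {} \<longleftrightarrow> mat_kernel M2 = mat_kernel M3)"
proof -
  obtain \<mu>0 where "representing_measure n p L \<mu>0" using assms(4) by blast
  then interpret mp: moment_problem n p L t \<mu>0
    using assms(2,3) by unfold_locales
  have T: "T = mp.T" by (simp add: T_def mp.T_def fun_eq_iff)
  have "(\<exists>\<mu>. minimal_representing_measure n p L \<mu> \<and> atom_mult \<mu> t = 0) \<longleftrightarrow> mp.shift_injective"
    using mp.shift_injective_imp_not_atom mp.shift_injective_if_not_atom
    unfolding minimal_representing_measure_def by blast
  moreover have "mp.shift_injective \<longleftrightarrow> A = {}"
    unfolding A_def comb_def y_def M1_def T by (rule mp.shift_injective_iff_columns)
  moreover have "mp.shift_injective \<longleftrightarrow> mat_kernel M2 = mat_kernel M3"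
    unfolding M2_def M3_def T by (rule mp.shift_injective_iff_kernels)
  ultimately show ?thesis by blast
qed

end
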